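(* Let $0\leq \alpha\leq 1$ and, for $\lambda$ in the open unit disc $\mathbb D$, let $\widehat k_\lambda^{\alpha}$ be the normalized reproducing kernel of the Dirichlet space $\mathcal D_\alpha$ at the point $\lambda$. Then, for any sequence $(\lambda_n)_{n\geq 1}$ in $\mathbb D$, the sequence $(\widehat k_{\lambda_n}^\alpha)_{n\geq 1}$ satisfies the Feichtinger Conjecture; that is, if $(\widehat k_{\lambda_n}^\alpha)_{n\geq 1}$ is a Bessel sequence in $\mathcal D_\alpha$, then it can be partitioned into finitely many Riesz sequences.
   Context: $\mathbb D$ is the open unit disc of $\mathbb C$. For $\alpha\in[0,1]$, $\mathcal D_\alpha$ is the Hilbert space of analytic functions $f$ on $\mathbb D$ such that $$\|f\|_{\mathcal D_\alpha}^2=|f(0)|^2+\int_{\mathbb D}|f'(z)|^2(1-|z|^2)^{1-\alpha}\,dA(z)<+\infty,$$ where $dA$ is area measure on $\mathbb D$. The reproducing kernel $k_\lambda^\alpha\in\mathcal D_\alpha$ at $\lambda\in\mathbb D$ is determined by $f(\lambda)=\langle f,k^\alpha_\lambda\rangle$ for all $f\in\mathcal D_\alpha$, and $\widehat k^\alpha_\lambda=k^\alpha_\lambda/\|k^\alpha_\lambda\|$. A (finite or countable) family $(x_n)_{n\in I}$ in a Hilbert space is a Riesz sequence if there are constants $A,B>0$ such that $A\sum |a_n|^2\leq \| \sum a_n x_n\|^2\leq B\sum |a_n|^2$ for all finitely supported complex families $(a_n)_{n\in I}$; it is a Bessel sequence if (at least) the right-hand inequality holds for some $B>0$. "Can be partitioned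 into finitely many Riesz sequences" means that the index set $\{1,2,3,\dots\}$ is a union of finitely many pairwise disjoint subsets $I_1,\dots,I_r$ such that each subfamily indexed by $I_j$ is a Riesz sequence. *)

theory Defs
  imports "HOL-Complex_Analysis.Complex_Analysis"
begin

abbreviation unit_disc :: "complex set" where
  "unit_disc \<equiv> ball 0 1"

text \<open>
  A function on the disc is represented by its extension by zero to the whole plane, so that
  equality in the space is equality of HOL functions.  Since the disc is open, the extension does
  not affect \<open>deriv f\<close> on the disc.
\<close>

definition dirichlet_space :: "real \<Rightarrow> (complex \<Rightarrow> complex) set" where
  "dirichlet_space \<alpha> =
    {f. f holomorphic_on unit_disc \<and> (\<forall>z. z \<notin> unit_disc \<longrightarrow> f z = 0) \<and>
        set_integrable lborel unit_disc
          (\<lambda>z. (cmod (deriv f z))\<^sup>2 * (1 - (cmod z)\<^sup>2) powr (1 - \<alpha>))}"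

text \<open>
  The norm and the inner product are meaningful on \<^term>\<open>dirichlet_space \<alpha>\<close> only; the inner product
  is the polarization of the squared norm, linear in its first argument.
\<close>

definition dirichlet_norm :: "real \<Rightarrow> (complex \<Rightarrow> complex) \<Rightarrow> real" where
  "dirichlet_norm \<alpha> f =
    sqrt ((cmod (f 0))\<^sup>2 +
      set_lebesgue_integral lborel unit_disc
        (\<lambda>z. (cmod (deriv f z))\<^sup>2 * (1 - (cmod z)\<^sup>2) powr (1 - \<alpha>)))"

definition dirichlet_inner ::
    "real \<Rightarrow> (complex \<Rightarrow> complex) \<Rightarrow> (complex \<Rightarrow> complex) \<Rightarrow> complex" where
  "dirichlet_inner \<alpha> f g =
    f 0 * cnj (g 0) +
      set_lebesgue_integral lborel unit_disc
        (\<lambda>z. deriv f z * cnj (deriv g z) * of_real ((1 - (cmod z)\<^sup>2) powr (1 - \<alpha>)))"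

definition dirichlet_kernel :: "real \<Rightarrow> complex \<Rightarrow> complex \<Rightarrow> complex" where
  "dirichlet_kernel \<alpha> \<mu> =
    (THE k. k \<in> dirichlet_space \<alpha> \<and>
      (\<forall>f \<in> dirichlet_space \<alpha>. f \<mu> = dirichlet_inner \<alpha> f k))"

definition normalized_dirichlet_kernel :: "real \<Rightarrow> complex \<Rightarrow> complex \<Rightarrow> complex" where
  "normalized_dirichlet_kernel \<alpha> \<mu> =
    (\<lambda>z. dirichlet_kernel \<alpha> \<mu> z / of_real (dirichlet_norm \<alpha> (dirichlet_kernel \<alpha> \<mu>)))"

text \<open>
  Bessel and Riesz sequences for a family indexed by \<open>I\<close> in a Hilbert space of complex functions with
  norm \<open>N\<close>.  A finitely supported coefficient family is given by a finite set \<open>F \<subseteq> I\<close> containing its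
  support and by its values on \<open>F\<close>.
\<close>

definition bessel_sequence ::
    "(('b \<Rightarrow> complex) \<Rightarrow> real) \<Rightarrow> 'i set \<Rightarrow> ('i \<Rightarrow> 'b \<Rightarrow> complex) \<Rightarrow> bool" where
  "bessel_sequence N I x \<longleftrightarrow>
    (\<exists>B>0. \<forall>F a. finite F \<and> F \<subseteq> I \<longrightarrow>
      (N (\<lambda>z. \<Sum>n\<in>F. a n * x n z))\<^sup>2 \<le> B * (\<Sum>n\<in>F. (cmod (a n))\<^sup>2))"

definition riesz_sequence ::
    "(('b \<Rightarrow> complex) \<Rightarrow> real) \<Rightarrow> 'i set \<Rightarrow> ('i \<Rightarrow> 'b \<Rightarrow> complex) \<Rightarrow> bool" where
  "riesz_sequence N I x \<longleftrightarrow>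
    (\<exists>A>0. \<exists>B>0. \<forall>F a. finite F \<and> F \<subseteq> I \<longrightarrow>
      A * (\<Sum>n\<in>F. (cmod (a n))\<^sup>2) \<le> (N (\<lambda>z. \<Sum>n\<in>F. a n * x n z))\<^sup>2 \<and>
      (N (\<lambda>z. \<Sum>n\<in>F. a n * x n z))\<^sup>2 \<le> B * (\<Sum>n\<in>F. (cmod (a n))\<^sup>2))"

end

(*
  The kernel of D_alpha at mu is a power series phi in z * cnj mu with explicit positive coefficients,
  because the monomials are orthogonal for the rotation-invariant weight and their norms are Beta
  integrals.  A Bessel sequence of normalized kernels is one whose Gram matrix is bounded.

  For alpha > 0, phi maps the disc, up to a bounded error, into a proper sector around the positive
  axis, so the matrix of absolute values of the Gram entries is bounded as well.  A bounded matrix with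
  nonnegative entries has a positive vector p with A p <= C p.  Colouring the indices so as to minimize
  the total weight p_i A_ij p_j of the monochromatic pairs makes the row sums inside each colour class
  small relative to p, and the Schur test then makes the off-diagonal part of each class small in norm.

  For alpha = 0 the norm is equivalent to that of the Hardy space.  Boundedness of the Gram matrix g of
  the normalized Szegoe kernels bounds the row sums of |g_ij|^2; by the same colouring argument these
  are at most 1/2 inside each class, so the Blaschke products of a class omitting one of its points are
  bounded below at that point.  As the inverse of a Cauchy matrix is a diagonal rescaling of its
  transpose, the Bessel bound then gives the lower Riesz bound.

  Both arguments colour finite sets of indices; a compactness argument gives the colouring of all of them.
*)
theory Submission
  imports Defs
begin

section \<open>Lebesgue measure on the disc\<close>

text \<open>The case \<alpha> = 0 stands apart because the leading part of its kernel is a multiple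
  of 1 / (1 - x), which maps the disc onto a half-plane: real parts no longer control absolute
  values. For 0 < \<alpha> < 1 the sector has half-angle (1 - \<alpha>) pi / 2 < pi / 2. The bounded
  error is harmless there because the constant coefficient of the kernel is 1, so that the Gram form
  dominates the squared modulus of the sum of the coefficients.

  The weights p are forced by what is known about A. A minimal colouring divides row sums by the
  number of colours, but a bound on the quadratic form does not bound the row sums of A; it bounds
  them only relative to p. For \<alpha> = 0 constant weights suffice, since the rows of a bounded
  matrix are uniformly square summable.

  Every estimate lives on a finite set, with constants and a number of colours that depend only on
  \<alpha> and the Bessel bound. Compactness requires this uniformity, and finiteness reduces the
  interpolation argument to polynomial algebra: an exact matrix inverse combined with an operator
  inequality.\<close>

definition complex_of_vec :: "real^2 \<Rightarrow> complex" where
  "complex_of_vec v = Complex (vec_nth v 1) (vec_nth v 2)"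

definition vec_of_complex :: "complex \<Rightarrow> real^2" where
  "vec_of_complex z = vector [Re z, Im z]"

lemma complex_of_vec_of_complex [simp]: "complex_of_vec (vec_of_complex z) = z"
  by (simp add: complex_of_vec_def vec_of_complex_def)

lemma vec_of_complex_of_vec [simp]: "vec_of_complex (complex_of_vec v) = v"
  by (simp add: complex_of_vec_def vec_of_complex_def vec_eq_iff forall_2)

lemma norm_complex_of_vec: "norm (complex_of_vec v) = norm v"
  by (simp add: complex_of_vec_def norm_vec_def L2_set_def sum_2 cmod_def)

lemma linear_complex_of_vec: "linear complex_of_vec"
  by (rule linearI) (simp_all add: complex_of_vec_def complex_eq_iff)

lemma linear_vec_of_complex: "linear vec_of_complex"
  by (rule linearI) (simp_all add: vec_of_complex_def vec_eq_iff forall_2)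

lemma borel_measurable_complex_of_vec [measurable]: "complex_of_vec \<in> borel_measurable borel"
  using linear_complex_of_vec
  by (intro borel_measurable_continuous_onI linear_continuous_on) (simp add: linear_conv_bounded_linear)

text \<open>Coordinates map boxes to boxes of the same volume, which characterizes Lebesgue measure.
  This carries facts about orthogonal maps of \<open>real^2\<close> over to the plane.\<close>

lemma lborel_complex_eq_distr: "(lborel :: complex measure) = distr lborel borel complex_of_vec"
proof (rule lborel_eqI)
  fix l u :: complex assume le: "\<And>b. b \<in> Basis \<Longrightarrow> l \<bullet> b \<le> u \<bullet> b"
  have le': "Re l \<le> Re u" "Im l \<le> Im u"
    using le[of 1] le[of \<i>] by (auto simp: Basis_complex_def)
  let ?l = "vec_of_complex l" and ?u = "vec_of_complex u"
  have eq: "complex_of_vec -` box l u = box ?l ?u"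
    by (auto simp: in_box_complex_iff mem_box_cart forall_2 complex_of_vec_def vec_of_complex_def)
  have "vec_nth ?l i \<le> vec_nth ?u i" for i
    using le' exhaust_2[of i] by (auto simp: vec_of_complex_def)
  then have "\<And>b. b \<in> Basis \<Longrightarrow> ?l \<bullet> b \<le> ?u \<bullet> b"
    by (auto simp: Basis_vec_def inner_axis)
  then have "emeasure lborel (box ?l ?u) = (\<Prod>b\<in>Basis. (?u - ?l) \<bullet> b)"
    by (rule emeasure_lborel_box)
  also have "(\<Prod>b\<in>Basis. (?u - ?l) \<bullet> b) = (\<Prod>i\<in>UNIV. vec_nth (?u - ?l) i)"
    by (rule prod.reindex_bij_witness[of _ "\<lambda>i. axis i 1" "\<lambda>b. THE i. b = axis i 1"])
       (auto simp: Basis_vec_def inner_axis axis_eq_axis)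
  also have "\<dots> = (\<Prod>b\<in>Basis. (u - l) \<bullet> b)"
    by (simp add: UNIV_2 vec_of_complex_def Basis_complex_def)
  finally show "emeasure (distr lborel borel complex_of_vec) (box l u) = (\<Prod>b\<in>Basis. (u - l) \<bullet> b)"
    by (simp add: emeasure_distr eq)
qed simp

text \<open>The preimage of a box is a tilted box, whose measure cannot be read off coordinatewise.
  It is the image of the box under \<open>?T\<close>, the inverse rotation in \<open>real^2\<close>,
  and orthogonal maps preserve Lebesgue measure.\<close>

lemma lborel_complex_distr_rotate:
  assumes "cmod \<omega> = 1"
  shows "distr lborel borel (\<lambda>z. \<omega> * z) = lborel"
proof (rule lborel_eqI[symmetric])
  fix l u :: complex assume le: "\<And>b. b \<in> Basis \<Longrightarrow> l \<bullet> b \<le> u \<bullet> b"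
  let ?T = "\<lambda>v. vec_of_complex (cnj \<omega> * complex_of_vec v)"
  have \<omega>: "\<omega> * cnj \<omega> = 1" "cnj \<omega> * \<omega> = 1"
    using assms by (simp_all add: complex_norm_square[symmetric] mult.commute)
  have 1: "orthogonal_transformation ?T"
    unfolding orthogonal_transformation
  proof (intro conjI allI)
    have "linear (\<lambda>z. cnj \<omega> * z)"
      by (rule linearI) (auto simp: algebra_simps)
    then show "linear ?T"
      using linear_compose[OF linear_complex_of_vec linear_compose[OF _ linear_vec_of_complex]]
      by (simp add: o_def)
    show "norm (?T v) = norm v" for v
      using assms norm_complex_of_vec[of "?T v"] norm_complex_of_vec[of v] by (simp add: norm_mult)
  qed
  define Q where "Q = complex_of_vec -` box l u"
  have Q: "Q = box (vec_of_complex l) (vec_of_complex u)"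
    by (auto simp: Q_def in_box_complex_iff mem_box_cart forall_2 complex_of_vec_def vec_of_complex_def)
  have "complex_of_vec -` ((\<lambda>z. \<omega> * z) -` box l u) = ?T ` Q"
  proof (intro set_eqI iffI)
    fix v assume "v \<in> complex_of_vec -` ((\<lambda>z. \<omega> * z) -` box l u)"
    then show "v \<in> ?T ` Q"
      by (intro image_eqI[of _ _ "vec_of_complex (\<omega> * complex_of_vec v)"])
        (auto simp: Q_def \<omega> mult.assoc[symmetric])
  qed (auto simp: Q_def \<omega> mult.assoc[symmetric])
  moreover have "(\<lambda>z. \<omega> * z) -` box l u \<in> sets borel"
    using measurable_sets_borel[of "\<lambda>z. \<omega> * z" borel "box l u"] by simp
  ultimately have TQ: "?T ` Q \<in> sets borel"
    using measurable_sets_borel[OF borel_measurable_complex_of_vec] by metis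
  have "emeasure lborel ((\<lambda>z. \<omega> * z) -` box l u) = emeasure lborel (?T ` Q)"
    using \<open>(\<lambda>z. \<omega> * z) -` box l u \<in> sets borel\<close> \<open>complex_of_vec -` _ = _\<close>
    by (subst lborel_complex_eq_distr, subst emeasure_distr) auto
  also have "\<dots> = emeasure lebesgue (?T ` Q)"
    using TQ by simp
  also have "\<dots> = emeasure lebesgue Q"
    using measure_orthogonal_image[OF 1, of Q] measurable_orthogonal_image[OF 1, of Q]
    by (auto simp: Q emeasure_eq_measure2 lmeasurable_box)
  also have "\<dots> = emeasure lborel Q"
    by (simp add: Q)
  also have "\<dots> = emeasure lborel (box l u)"
    by (subst lborel_complex_eq_distr, subst emeasure_distr) (auto simp: Q_def)
  finally show "emeasure (distr lborel borel (\<lambda>z. \<omega> * z)) (box l u) = (\<Prod>b\<in>Basis. (u - l) \<bullet> b)"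
    using le by (simp add: emeasure_distr emeasure_lborel_box)
qed simp


text \<open>The part of the disc where the squared modulus exceeds x in [0, 1) has area pi (1 - x),
  and finite measures on the line are determined by half-lines. For radial integrands this replaces
  polar coordinates.\<close>

lemma distr_cmod_power2_unit_disc:
  "distr (density lborel (indicator unit_disc)) borel (\<lambda>z. (cmod z)\<^sup>2) =
   density lborel (\<lambda>t. ennreal pi * indicator {0<..<1} t)" (is "?M = ?N")
proof (rule measure_eqI_lessThan)
  have ind: "(indicator unit_disc :: complex \<Rightarrow> ennreal) \<in> borel_measurable borel"
    by (intro borel_measurable_indicator) auto
  have M: "emeasure ?M {x<..} = emeasure lborel (unit_disc \<inter> {z. x < (cmod z)\<^sup>2})" for x
  proof -
    have "{z::complex. x < (cmod z)\<^sup>2} \<in> sets borel"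
      by measurable
    moreover have "(\<lambda>z. (cmod z)\<^sup>2) -` {x<..} = {z. x < (cmod z)\<^sup>2}"
      by auto
    moreover have "emeasure (density lborel (indicator unit_disc)) A = emeasure lborel (unit_disc \<inter> A)"
      if "A \<in> sets borel" for A :: "complex set"
    proof -
      have "emeasure (density lborel (indicator unit_disc)) A =
          (\<integral>\<^sup>+ z. indicator unit_disc z * indicator A z \<partial>lborel)"
        using that ind by (intro emeasure_density) auto
      also have "\<dots> = (\<integral>\<^sup>+ z. indicator (unit_disc \<inter> A) z \<partial>lborel)"
        by (intro nn_integral_cong) (auto simp: indicator_def)
      also have "\<dots> = emeasure lborel (unit_disc \<inter> A)"
        using that by (intro nn_integral_indicator) auto
      finally show ?thesis .
    qed
    ultimately show ?thesis
      by (simp add: emeasure_distr)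
  qed
  have N: "emeasure ?N {x<..} = ennreal pi * emeasure lborel ({0<..<1} \<inter> {x<..})" for x
  proof -
    have "emeasure ?N {x<..} = (\<integral>\<^sup>+ t. ennreal pi * indicator {0<..<1} t * indicator {x<..} t \<partial>lborel)"
      by (subst emeasure_density) auto
    also have "\<dots> = (\<integral>\<^sup>+ t. ennreal pi * indicator ({0<..<1} \<inter> {x<..}) t \<partial>lborel)"
      by (intro nn_integral_cong) (auto simp: indicator_def)
    also have "\<dots> = ennreal pi * emeasure lborel ({0<..<1} \<inter> {x<..})"
      by (intro nn_integral_cmult_indicator) auto
    finally show ?thesis .
  qed
  have disc: "emeasure lborel unit_disc = ennreal pi"
    by (simp add: emeasure_ball unit_ball_vol_2)
  show "emeasure ?M {x<..} < \<infinity>" for x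
  proof -
    have "emeasure ?M {x<..} \<le> emeasure lborel unit_disc"
      unfolding M by (rule emeasure_mono) auto
    then show ?thesis by (auto simp: disc intro: le_less_trans)
  qed
  show "emeasure ?M {x<..} = emeasure ?N {x<..}" for x
  proof -
    consider "x < 0" | "0 \<le> x" "x < 1" | "x \<ge> 1" by linarith
    then show ?thesis
    proof cases
      case 1
      have "x < (cmod z)\<^sup>2" for z :: complex
        using 1 zero_le_power2[of "cmod z"] by linarith
      then have "unit_disc \<inter> {z. x < (cmod z)\<^sup>2} = unit_disc"
        by blast
      moreover have "{0<..<1} \<inter> {x<..} = {0<..<1}" using 1 by auto
      ultimately show ?thesis unfolding M N by (simp add: disc)
    next
      case 2
      have "x < (cmod z)\<^sup>2 \<longleftrightarrow> z \<notin> cball 0 (sqrt x)" for z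
        using real_sqrt_less_iff[of x "(cmod z)\<^sup>2"] by (simp add: not_le)
      then have "unit_disc \<inter> {z. x < (cmod z)\<^sup>2} = unit_disc - cball 0 (sqrt x)"
        by blast
      moreover have "emeasure lborel (unit_disc - cball 0 (sqrt x)) = ennreal pi - ennreal (pi * x)"
      proof -
        have "cball 0 (sqrt x) \<subseteq> unit_disc"
          using 2 by (simp add: cball_subset_ball_iff)
        moreover have "emeasure lborel (cball (0::complex) (sqrt x)) = ennreal (pi * x)"
          using 2 by (simp add: emeasure_cball unit_ball_vol_2)
        ultimately show ?thesis
          by (subst emeasure_Diff) (simp_all add: disc)
      qed
      moreover have "{0<..<1} \<inter> {x<..} = {x<..<1}" using 2 by auto
      moreover have "ennreal pi - ennreal (pi * x) = ennreal pi * ennreal (1 - x)"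
      proof -
        have "ennreal pi - ennreal (pi * x) = ennreal (pi - pi * x)"
          using 2 by (intro ennreal_minus) simp
        also have "pi - pi * x = pi * (1 - x)"
          by (rule right_diff_distrib'[symmetric, of pi 1 x, simplified])
        also have "ennreal (pi * (1 - x)) = ennreal pi * ennreal (1 - x)"
          by (intro ennreal_mult') simp
        finally show ?thesis .
      qed
      moreover have "emeasure lborel {x<..<1} = ennreal (1 - x)"
        using 2 by simp
      ultimately show ?thesis by (simp only: M N)
    next
      case 3
      have "\<not> x < (cmod z)\<^sup>2" if "z \<in> unit_disc" for z
        using that 3 abs_square_less_1[of "cmod z"] by simp
      then have "unit_disc \<inter> {z. x < (cmod z)\<^sup>2} = {}"
        by blast
      moreover have "{0<..<1} \<inter> {x<..} = {}" using 3 by auto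
      ultimately show ?thesis unfolding M N by simp
    qed
  qed
qed simp_all

section \<open>Moments of the weight and integration against monomials\<close>

definition dirichlet_weight :: "real \<Rightarrow> complex \<Rightarrow> real" where
  "dirichlet_weight \<alpha> z = (1 - (cmod z)\<^sup>2) powr (1 - \<alpha>)"

lemma borel_measurable_dirichlet_weight [measurable]: "dirichlet_weight \<alpha> \<in> borel_measurable borel"
  unfolding dirichlet_weight_def by measurable

text \<open>In the variable t = |z|^2 this is Euler's Beta integral.\<close>

lemma set_integral_moment:
  assumes "\<alpha> \<le> 1"
  shows "(LINT z:unit_disc|lborel. (cmod z) ^ (2 * l) * dirichlet_weight \<alpha> z)
     = pi * Beta (real l + 1) (2 - \<alpha>)"
proof -
  define g where "g = (\<lambda>t::real. t ^ l * (1 - t) powr (1 - \<alpha>))"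
  have [measurable]: "g \<in> borel_measurable borel"
    unfolding g_def by measurable
  have "(LINT z:unit_disc|lborel. (cmod z) ^ (2 * l) * dirichlet_weight \<alpha> z)
     = (LINT z|density lborel (indicator unit_disc). g ((cmod z)\<^sup>2))"
  proof -
    have "(indicator unit_disc :: complex \<Rightarrow> real) \<in> borel_measurable borel"
      by (intro borel_measurable_indicator) auto
    then show ?thesis
      using integral_density[of "\<lambda>z. g ((cmod z)\<^sup>2)" lborel "indicator unit_disc"]
      by (simp add: set_lebesgue_integral_def g_def dirichlet_weight_def power_mult ennreal_indicator)
  qed
  also have "\<dots> = (LINT t|distr (density lborel (indicator unit_disc)) borel (\<lambda>z. (cmod z)\<^sup>2). g t)"
    by (subst integral_distr) auto
  also have "\<dots> = (LINT t|density lborel (\<lambda>t. ennreal (pi * indicator {0<..<1} t)). g t)"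
    unfolding distr_cmod_power2_unit_disc by (simp add: ennreal_mult' ennreal_indicator)
  also have "\<dots> = pi * (LINT t:{0<..<1}|lborel. g t)"
    by (subst integral_density) (auto simp: set_lebesgue_integral_def mult.assoc)
  also have "(LINT t:{0<..<1}|lborel. g t)
    = (LINT t:{0<..<1}|lborel. t powr (real l + 1 - 1) * (1 - t) powr (2 - \<alpha> - 1))"
    by (rule set_lebesgue_integral_cong) (auto simp: g_def powr_realpow)
  also have "\<dots> = (LINT t:{0..1}|lborel. t powr (real l + 1 - 1) * (1 - t) powr (2 - \<alpha> - 1))"
    unfolding set_lebesgue_integral_def
    by (rule integral_cong_AE)
       (use AE_lborel_singleton[of "0::real"] AE_lborel_singleton[of "1::real"] in
        \<open>auto simp: indicator_def elim!: eventually_rev_mp\<close>)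
  also have "\<dots> = Beta (real l + 1) (2 - \<alpha>)"
    using has_integral_Beta_real[of "real l + 1" "2 - \<alpha>"] integrable_Beta[of "real l + 1" "2 - \<alpha>"] assms
    by (subst set_borel_integral_eq_integral) (auto intro!: integral_unique)
  finally show ?thesis .
qed

text \<open>The rotation by \<omega> preserves the disc and the weight and is chosen to multiply the
  monomial by -1, so the integral equals its own negative.\<close>

lemma set_integral_monomial_orthogonal:
  assumes "j \<noteq> l"
  shows "(LINT z:ball 0 \<rho>|lborel. z ^ j * cnj z ^ l * of_real (dirichlet_weight \<alpha> z)) = 0"
proof -
  define \<omega> where "\<omega> = cis (pi / (real j - real l))"
  have \<omega>: "\<omega> ^ j * cnj \<omega> ^ l = -1"
  proof -
    have "\<omega> ^ j * cnj \<omega> ^ l = cis (real j * (pi / (real j - real l)) - real l * (pi / (real j - real l)))"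
      by (simp add: \<omega>_def cis_cnj Complex.DeMoivre cis_mult)
    also have "real j * (pi / (real j - real l)) - real l * (pi / (real j - real l)) = pi"
      using assms by (subst left_diff_distrib[symmetric]) simp
    finally show ?thesis by simp
  qed
  have n: "cmod \<omega> = 1" by (simp add: \<omega>_def)
  have [measurable]: "cnj \<in> borel_measurable borel"
    by (intro borel_measurable_continuous_onI continuous_intros)
  have [measurable]: "(indicator (ball 0 \<rho>) :: complex \<Rightarrow> real) \<in> borel_measurable borel"
    by (intro borel_measurable_indicator) auto
  let ?h = "\<lambda>z. indicator (ball 0 \<rho>) z *\<^sub>R (z ^ j * cnj z ^ l * of_real (dirichlet_weight \<alpha> z))"
  have "(LINT z|lborel. ?h z) = (LINT z|distr lborel borel (\<lambda>z. \<omega> * z). ?h z)"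
    by (simp only: lborel_complex_distr_rotate[OF n])
  also have "\<dots> = (LINT z|lborel. ?h (\<omega> * z))"
    by (rule integral_distr) auto
  also have "\<dots> = (LINT z|lborel. (\<omega> ^ j * cnj \<omega> ^ l) * ?h z)"
    by (rule Bochner_Integration.integral_cong)
       (auto simp: indicator_def dirichlet_weight_def norm_mult n power_mult_distrib)
  also have "\<dots> = - (LINT z|lborel. ?h z)"
    unfolding \<omega> by simp
  finally show ?thesis by (simp add: set_lebesgue_integral_def equation_minus_iff)
qed

text \<open>The majorant of the n-th term is \<open>B n\<close> times the modulus of
  \<open>u\<close>. The factor \<open>u\<close> is kept apart because in the reproducing formula it
  is merely integrable, while the other factor has a uniformly convergent expansion.\<close>

lemma sums_set_lebesgue_integral_mult:
  fixes u s :: "'a \<Rightarrow> complex"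
  assumes u: "set_integrable M A u"
    and meas: "\<And>n. set_borel_measurable M A (\<lambda>z. u z * v n z)"
    and bound: "\<And>n z. z \<in> A \<Longrightarrow> cmod (v n z) \<le> B n" and "summable B"
    and sums: "\<And>z. z \<in> A \<Longrightarrow> (\<lambda>n. v n z) sums s z"
  shows "(\<lambda>n. LINT z:A|M. u z * v n z) sums (LINT z:A|M. u z * s z)"
proof (cases "A = {}")
  case True
  then show ?thesis by (simp add: set_lebesgue_integral_def)
next
  case False
  then obtain z0 where "z0 \<in> A" by blast
  then have B: "B n \<ge> 0" for n
    using bound[of z0 n] norm_ge_zero order_trans by blast
  let ?F = "\<lambda>n z. indicat_real A z *\<^sub>R (u z * v n z)"
  have le: "norm (?F n z) \<le> B n * norm (indicat_real A z *\<^sub>R u z)" for n z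
    using mult_left_mono[OF bound[of z n], of "cmod (u z)"]
    by (auto simp: indicator_def norm_mult mult.commute)
  have int: "integrable M (?F n)" for n
  proof (rule Bochner_Integration.integrable_bound)
    show "integrable M (\<lambda>z. B n * norm (indicat_real A z *\<^sub>R u z))"
      using u unfolding set_integrable_def by (intro integrable_mult_right integrable_norm)
    show "?F n \<in> borel_measurable M"
      using meas by (simp add: set_borel_measurable_def)
    show "AE z in M. norm (?F n z) \<le> norm (B n * norm (indicat_real A z *\<^sub>R u z))"
      using le B by (intro always_eventually allI) (simp add: abs_mult)
  qed
  have "(\<lambda>n. integral\<^sup>L M (?F n)) sums (\<integral>z. (\<Sum>n. ?F n z) \<partial>M)"
  proof (rule sums_integral)
    show "AE z in M. summable (\<lambda>n. norm (?F n z))"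
      by (intro always_eventually allI summable_comparison_test'[OF summable_mult2[OF \<open>summable B\<close>]])
         (use le in auto)
    show "summable (\<lambda>n. \<integral>z. norm (?F n z) \<partial>M)"
    proof (rule summable_comparison_test')
      show "summable (\<lambda>n. B n * (\<integral>z. norm (indicat_real A z *\<^sub>R u z) \<partial>M))"
        using \<open>summable B\<close> by (rule summable_mult2)
      fix n
      have "(\<integral>z. norm (?F n z) \<partial>M) \<le> (\<integral>z. B n * norm (indicat_real A z *\<^sub>R u z) \<partial>M)"
        using int u le unfolding set_integrable_def
        by (intro integral_mono integrable_norm integrable_mult_right) auto
      then show "norm (\<integral>z. norm (?F n z) \<partial>M) \<le> B n * (\<integral>z. norm (indicat_real A z *\<^sub>R u z) \<partial>M)"
        by simp
    qed
  qed fact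
  also have "(\<lambda>z. \<Sum>n. ?F n z) = (\<lambda>z. indicat_real A z *\<^sub>R (u z * s z))"
  proof
    fix z show "(\<Sum>n. ?F n z) = indicat_real A z *\<^sub>R (u z * s z)"
      using sums_mult[OF sums[of z], of "u z"] by (auto simp: indicator_def dest: sums_unique[symmetric])
  qed
  finally show ?thesis by (simp add: set_lebesgue_integral_def)
qed

lemma set_borel_measurable_continuous_on_open:
  fixes f :: "complex \<Rightarrow> 'b::real_normed_vector"
  assumes "open A" "continuous_on A f"
  shows "set_borel_measurable lborel A f"
  using borel_measurable_continuous_on_indicator[OF _ assms(2)] assms(1)
  by (simp add: set_borel_measurable_def)

lemma set_integrable_continuous_on_bounded:
  fixes f :: "complex \<Rightarrow> 'b::{banach, second_countable_topology}"
  assumes A: "open A" "bounded A" and "continuous_on A f" and "\<And>z. z \<in> A \<Longrightarrow> norm (f z) \<le> B"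
  shows "set_integrable lborel A f"
proof (rule set_integrable_bound)
  show "set_integrable lborel A (\<lambda>z. B)"
    using A emeasure_bounded_finite[OF A(2)] by (simp add: set_integrable_def integrable_indicator_iff)
  show "set_borel_measurable lborel A f"
    using assms by (intro set_borel_measurable_continuous_on_open)
  show "AE z in lborel. z \<in> A \<longrightarrow> norm (f z) \<le> norm B"
    using assms(4) by (intro always_eventually) force
qed

lemma continuous_on_dirichlet_weight: "continuous_on unit_disc (dirichlet_weight \<alpha>)"
  unfolding dirichlet_weight_def
  by (intro continuous_intros) (auto simp: abs_square_eq_1)

lemma dirichlet_weight_bounds:
  assumes "\<alpha> \<le> 1" "z \<in> unit_disc"
  shows "0 \<le> dirichlet_weight \<alpha> z" "dirichlet_weight \<alpha> z \<le> 1"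
proof -
  have "(cmod z)\<^sup>2 \<le> 1" using assms abs_square_le_1[of "cmod z"] by simp
  then show "0 \<le> dirichlet_weight \<alpha> z" "dirichlet_weight \<alpha> z \<le> 1"
    unfolding dirichlet_weight_def using assms by (auto intro!: powr_le1)
qed

text \<open>For \<rho> < 1 the Taylor series of \<open>g\<close> converges uniformly on the disc of
  integration; after termwise integration orthogonality leaves the term n = l.\<close>

lemma set_integral_monomial_smaller_disc:
  assumes \<alpha>: "\<alpha> \<le> 1" and g: "g holomorphic_on unit_disc" and \<rho>: "0 < \<rho>" "\<rho> < 1"
  shows "(LINT z:ball 0 \<rho>|lborel. g z * cnj z ^ l * of_real (dirichlet_weight \<alpha> z)) =
     (deriv ^^ l) g 0 / fact l *
       of_real (LINT z:ball 0 \<rho>|lborel. cmod z ^ (2 * l) * dirichlet_weight \<alpha> z)"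
proof -
  define b where "b = (\<lambda>n. (deriv ^^ n) g 0 / fact n)"
  have b: "(\<lambda>n. b n * z ^ n) sums g z" if "z \<in> unit_disc" for z
    using holomorphic_power_series[OF g that] by (simp add: b_def)
  have sub: "ball 0 \<rho> \<subseteq> unit_disc" using \<rho> by auto
  let ?u = "\<lambda>z. cnj z ^ l * complex_of_real (dirichlet_weight \<alpha> z)"
  have contW: "continuous_on (ball 0 \<rho>) (dirichlet_weight \<alpha>)"
    using continuous_on_dirichlet_weight sub continuous_on_subset by blast
  have "(\<lambda>n. LINT z:ball 0 \<rho>|lborel. ?u z * (b n * z ^ n)) sums (LINT z:ball 0 \<rho>|lborel. ?u z * g z)"
  proof (rule sums_set_lebesgue_integral_mult)
    show "set_integrable lborel (ball 0 \<rho>) ?u"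
    proof (rule set_integrable_continuous_on_bounded)
      show "continuous_on (ball 0 \<rho>) ?u"
        by (intro continuous_intros contW)
      fix z :: complex assume "z \<in> ball 0 \<rho>"
      then have "z \<in> unit_disc" using sub by blast
      then have "cmod z ^ l \<le> 1" "0 \<le> dirichlet_weight \<alpha> z" "dirichlet_weight \<alpha> z \<le> 1"
        using dirichlet_weight_bounds[OF \<alpha>, of z] by (auto intro: power_le_one)
      then show "norm (?u z) \<le> 1"
        using mult_mono[of "cmod z ^ l" 1 "dirichlet_weight \<alpha> z" 1] by (simp add: norm_mult norm_power)
    qed auto
    show "set_borel_measurable lborel (ball 0 \<rho>) (\<lambda>z. ?u z * (b n * z ^ n))" for n
      by (intro set_borel_measurable_continuous_on_open continuous_intros contW) auto
    show "cmod (b n * z ^ n) \<le> cmod (b n) * \<rho> ^ n" if "z \<in> ball 0 \<rho>" for n z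
      using that by (auto simp: norm_mult norm_power intro!: mult_left_mono power_mono)
    show "summable (\<lambda>n. cmod (b n) * \<rho> ^ n)"
    proof -
      \<comment> \<open>A point with modulus strictly between \<rho> and 1: convergence there gives
        absolute convergence at \<rho>.\<close>
      define x where "x = complex_of_real ((1 + \<rho>) / 2)"
      have nx: "cmod x = (1 + \<rho>) / 2"
        unfolding x_def norm_of_real using \<rho> by simp
      have "summable (\<lambda>n. b n * x ^ n)"
        using nx \<rho> b[of x] by (auto intro: sums_summable)
      moreover have "norm (complex_of_real \<rho>) < norm x"
        using \<rho> by (simp add: nx)
      ultimately have "summable (\<lambda>n. norm (b n * of_real \<rho> ^ n))"
        by (rule powser_insidea)
      then show ?thesis using \<rho> by (simp add: norm_mult norm_power)
    qed
    show "(\<lambda>n. b n * z ^ n) sums g z" if "z \<in> ball 0 \<rho>" for z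
      using that sub b by blast
  qed
  also have "(\<lambda>n. LINT z:ball 0 \<rho>|lborel. ?u z * (b n * z ^ n)) =
     (\<lambda>n. b n * (LINT z:ball 0 \<rho>|lborel. z ^ n * cnj z ^ l * complex_of_real (dirichlet_weight \<alpha> z)))"
    by (simp add: mult_ac flip: set_integral_mult_right)
  finally have "(\<lambda>n. b n * (LINT z:ball 0 \<rho>|lborel. z ^ n * cnj z ^ l * complex_of_real (dirichlet_weight \<alpha> z)))
     sums (LINT z:ball 0 \<rho>|lborel. ?u z * g z)" .
  moreover have "(\<lambda>n. b n * (LINT z:ball 0 \<rho>|lborel. z ^ n * cnj z ^ l * complex_of_real (dirichlet_weight \<alpha> z)))
     sums (b l * (LINT z:ball 0 \<rho>|lborel. z ^ l * cnj z ^ l * complex_of_real (dirichlet_weight \<alpha> z)))"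
    using sums_finite[of "{l}" "\<lambda>n. b n * (LINT z:ball 0 \<rho>|lborel. z ^ n * cnj z ^ l * complex_of_real (dirichlet_weight \<alpha> z))"]
      set_integral_monomial_orthogonal by simp
  ultimately have "(LINT z:ball 0 \<rho>|lborel. ?u z * g z) =
     b l * (LINT z:ball 0 \<rho>|lborel. z ^ l * cnj z ^ l * complex_of_real (dirichlet_weight \<alpha> z))"
    by (rule sums_unique2)
  moreover have "z ^ l * cnj z ^ l * complex_of_real (dirichlet_weight \<alpha> z) =
     complex_of_real (cmod z ^ (2 * l) * dirichlet_weight \<alpha> z)" for z
    by (simp add: power_mult_distrib[symmetric] complex_norm_square[symmetric] power_mult)
  moreover have "?u z * g z = g z * cnj z ^ l * of_real (dirichlet_weight \<alpha> z)" for z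
    by (simp add: mult_ac)
  ultimately show ?thesis
    by (simp only: b_def set_integral_complex_of_real)
qed

text \<open>The power series of \<open>g\<close> can be integrated termwise on smaller discs only, hence the limit.\<close>

lemma set_integral_monomial:
  assumes \<alpha>: "\<alpha> \<le> 1" and g: "g holomorphic_on unit_disc"
    and int: "set_integrable lborel unit_disc (\<lambda>z. g z * of_real (dirichlet_weight \<alpha> z))"
  shows "(LINT z:unit_disc|lborel. g z * cnj z ^ l * of_real (dirichlet_weight \<alpha> z)) =
     (deriv ^^ l) g 0 / fact l * of_real (pi * Beta (real l + 1) (2 - \<alpha>))"
proof -
  \<comment> \<open>The shift by 2 makes already the first radius positive, as the lemma on smaller
    discs demands.\<close>
  define A where "A = (\<lambda>k::nat. ball (0::complex) (1 - 1 / (real k + 2)))"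
  have A: "\<And>k. A k \<in> sets lborel" "incseq A" "(\<Union>k. A k) = unit_disc"
  proof -
    show "incseq A"
      unfolding A_def by (intro incseq_SucI subset_ball) (simp add: field_simps)
    show "(\<Union>k. A k) = unit_disc"
    proof (intro equalityI subsetI)
      fix z assume "z \<in> (\<Union>k. A k)"
      then obtain k where "cmod z < 1 - 1 / (real k + 2)" by (auto simp: A_def)
      moreover have "1 / (real k + 2) > 0" by simp
      ultimately show "z \<in> unit_disc" unfolding mem_ball_0 by linarith
    next
      fix z :: complex assume "z \<in> unit_disc"
      then obtain k where "inverse (real (Suc k)) < 1 - cmod z"
        using reals_Archimedean[of "1 - cmod z"] by auto
      moreover have "1 / (real k + 2) \<le> inverse (real (Suc k))"
        by (simp add: field_simps)
      ultimately have "z \<in> A k" by (simp add: A_def)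
      then show "z \<in> (\<Union>k. A k)" by blast
    qed
  qed (auto simp: A_def)
  have cont: "continuous_on unit_disc g" using g by (rule holomorphic_on_imp_continuous_on)
  have pow: "cmod z ^ l \<le> 1" if "z \<in> unit_disc" for z l
    using that by (auto intro: power_le_one)
  have int1: "set_integrable lborel unit_disc (\<lambda>z. g z * cnj z ^ l * of_real (dirichlet_weight \<alpha> z))"
  proof (rule set_integrable_bound[OF int])
    show "set_borel_measurable lborel unit_disc (\<lambda>z. g z * cnj z ^ l * of_real (dirichlet_weight \<alpha> z))"
      by (intro set_borel_measurable_continuous_on_open continuous_intros cont continuous_on_dirichlet_weight) auto
    show "AE z in lborel. z \<in> unit_disc \<longrightarrow> norm (g z * cnj z ^ l * of_real (dirichlet_weight \<alpha> z))
       \<le> norm (g z * of_real (dirichlet_weight \<alpha> z))"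
    proof (intro always_eventually allI impI)
      fix z :: complex assume "z \<in> unit_disc"
      from mult_left_mono[OF pow[OF this, of l], of "norm (g z * of_real (dirichlet_weight \<alpha> z))"]
      show "norm (g z * cnj z ^ l * of_real (dirichlet_weight \<alpha> z))
       \<le> norm (g z * of_real (dirichlet_weight \<alpha> z))"
        by (simp add: norm_mult norm_power mult_ac)
    qed
  qed
  have int2: "set_integrable lborel unit_disc (\<lambda>z. cmod z ^ (2 * l) * dirichlet_weight \<alpha> z)"
  proof (rule set_integrable_continuous_on_bounded)
    show "norm (cmod z ^ (2 * l) * dirichlet_weight \<alpha> z) \<le> 1" if "z \<in> unit_disc" for z
      using dirichlet_weight_bounds[OF \<alpha> that] pow[OF that, of "2 * l"]
        mult_mono[of "cmod z ^ (2*l)" 1 "dirichlet_weight \<alpha> z" 1] by (simp add: abs_mult)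
  qed (auto intro!: continuous_intros continuous_on_dirichlet_weight)
  have "(\<lambda>k. LINT z:A k|lborel. g z * cnj z ^ l * of_real (dirichlet_weight \<alpha> z)) \<longlonglongrightarrow>
     (LINT z:unit_disc|lborel. g z * cnj z ^ l * of_real (dirichlet_weight \<alpha> z))"
    using set_integral_cont_up[of A lborel, OF A(1,2)] int1 by (simp add: A(3))
  moreover have "(\<lambda>k. LINT z:A k|lborel. g z * cnj z ^ l * of_real (dirichlet_weight \<alpha> z)) =
    (\<lambda>k. (deriv ^^ l) g 0 / fact l * of_real (LINT z:A k|lborel. cmod z ^ (2 * l) * dirichlet_weight \<alpha> z))"
    unfolding A_def
    by (intro ext set_integral_monomial_smaller_disc[OF \<alpha> g]) (auto simp: field_simps)
  moreover have "(\<lambda>k. (deriv ^^ l) g 0 / fact l * of_real (LINT z:A k|lborel. cmod z ^ (2 * l) * dirichlet_weight \<alpha> z))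
     \<longlonglongrightarrow> (deriv ^^ l) g 0 / fact l * of_real (LINT z:unit_disc|lborel. cmod z ^ (2 * l) * dirichlet_weight \<alpha> z)"
    using set_integral_cont_up[of A lborel, OF A(1,2)] int2
    by (intro tendsto_intros) (simp_all add: A(3))
  ultimately show ?thesis
    by (simp add: LIMSEQ_unique set_integral_moment[OF \<alpha>])
qed

section \<open>The reproducing kernel\<close>

text \<open>For n > 0 this is the reciprocal of the squared norm n^2 pi Beta(n, 2 - \<alpha>) of
  z^n, with the Gamma quotient written out. The factor pi stems from the unnormalized area
  measure.\<close>

definition kernel_coeff :: "real \<Rightarrow> nat \<Rightarrow> real" where
  "kernel_coeff \<alpha> n = (if n = 0 then 1 else pochhammer (2 - \<alpha>) n / (pi * real n * fact n))"

definition kernel_series :: "real \<Rightarrow> complex \<Rightarrow> complex" where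
  "kernel_series \<alpha> x = (\<Sum>n. of_real (kernel_coeff \<alpha> n) * x ^ n)"

text \<open>The cut-off outside the disc matches the encoding in \<open>dirichlet_space\<close>,
  where uniqueness of the kernel means equality of HOL functions.\<close>

definition kernel_fun :: "real \<Rightarrow> complex \<Rightarrow> complex \<Rightarrow> complex" where
  "kernel_fun \<alpha> \<mu> z = (if z \<in> unit_disc then kernel_series \<alpha> (cnj \<mu> * z) else 0)"

lemma kernel_coeff_0 [simp]: "kernel_coeff \<alpha> 0 = 1"
  by (simp add: kernel_coeff_def)

lemma kernel_coeff_pos: "\<alpha> \<le> 1 \<Longrightarrow> kernel_coeff \<alpha> n > 0"
  by (auto simp: kernel_coeff_def intro!: divide_pos_pos mult_pos_pos pochhammer_pos)

text \<open>Makes the geometric series a majorant of the kernel; for \<alpha> = 0 it is also one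
  half of the comparison with the Szego kernel.\<close>

lemma kernel_coeff_le_1:
  assumes "0 \<le> \<alpha>" "\<alpha> \<le> 1"
  shows "kernel_coeff \<alpha> n \<le> 1"
proof (cases "n = 0")
  case False
  have "pochhammer (2 - \<alpha>) n \<le> pochhammer 2 n"
  proof (induction n)
    case (Suc n)
    then show ?case
      unfolding pochhammer_Suc using assms
      by (intro mult_mono) (auto intro!: pochhammer_nonneg)
  qed simp
  also have "\<dots> = (real n + 1) * fact n"
    using pochhammer_rec[of "1::real" n] by (simp add: pochhammer_fact[symmetric] add.commute)
  also have "\<dots> \<le> (pi * real n) * fact n"
  proof (rule mult_right_mono)
    have "real n + 1 \<le> 2 * real n" using False by simp
    also have "\<dots> \<le> pi * real n" using pi_ge_two by (intro mult_right_mono) auto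
    finally show "real n + 1 \<le> pi * real n" .
  qed simp
  finally show ?thesis using False by (simp add: kernel_coeff_def)
qed simp

text \<open>The identity behind the reproducing property: one factor \<open>Suc n\<close> comes from
  differentiating the function, the other from differentiating the kernel.\<close>

lemma kernel_coeff_moment:
  assumes "\<alpha> \<le> 1"
  shows "kernel_coeff \<alpha> (Suc n) * (real (Suc n))\<^sup>2 * (pi * Beta (real n + 1) (2 - \<alpha>)) = 1"
proof -
  have nz: "2 - \<alpha> \<notin> \<int>\<^sub>\<le>\<^sub>0" using assms by (auto elim!: nonpos_Ints_cases)
  have pos: "pochhammer (2 - \<alpha>) (Suc n) > 0" using assms by (intro pochhammer_pos) auto
  have "Beta (real n + 1) (2 - \<alpha>) = fact n / pochhammer (2 - \<alpha>) (Suc n)"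
    unfolding pochhammer_Gamma[OF nz]
    using Gamma_fact[of n, where ?'a = real] by (simp add: Beta_def add_ac)
  then show ?thesis using pos
    by (simp add: kernel_coeff_def field_simps power2_eq_square del: of_nat_Suc)
qed

lemma summable_kernel_series:
  assumes "0 \<le> \<alpha>" "\<alpha> \<le> 1" "cmod x < 1"
  shows "summable (\<lambda>n. cmod (of_real (kernel_coeff \<alpha> n) * x ^ n))"
proof (rule summable_comparison_test')
  show "summable (\<lambda>n. cmod x ^ n)" using assms by (intro summable_geometric) auto
  show "norm (cmod (of_real (kernel_coeff \<alpha> n) * x ^ n)) \<le> cmod x ^ n" for n
    using kernel_coeff_le_1[OF assms(1,2), of n] kernel_coeff_pos[OF assms(2), of n]
      mult_right_mono[of "kernel_coeff \<alpha> n" 1 "cmod x ^ n"]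
    by (simp add: norm_mult norm_power)
qed

lemma kernel_series_sums:
  assumes "0 \<le> \<alpha>" "\<alpha> \<le> 1" "cmod x < 1"
  shows "(\<lambda>n. of_real (kernel_coeff \<alpha> n) * x ^ n) sums kernel_series \<alpha> x"
  unfolding kernel_series_def
  by (rule summable_sums, rule summable_norm_cancel, rule summable_kernel_series[OF assms])

lemma kernel_series_0 [simp]: "kernel_series \<alpha> 0 = 1"
  unfolding kernel_series_def using powser_zero[of "\<lambda>n. of_real (kernel_coeff \<alpha> n)"] by simp

lemma kernel_series_cnj:
  assumes "0 \<le> \<alpha>" "\<alpha> \<le> 1" "cmod x < 1"
  shows "kernel_series \<alpha> (cnj x) = cnj (kernel_series \<alpha> x)"
proof (rule sums_unique2)
  show "(\<lambda>n. of_real (kernel_coeff \<alpha> n) * cnj x ^ n) sums kernel_series \<alpha> (cnj x)"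
    using assms by (intro kernel_series_sums) auto
  show "(\<lambda>n. of_real (kernel_coeff \<alpha> n) * cnj x ^ n) sums cnj (kernel_series \<alpha> x)"
    using iffD2[OF sums_cnj kernel_series_sums[OF assms]] by simp
qed

lemma cmod_mult_disc: "z \<in> unit_disc \<Longrightarrow> w \<in> unit_disc \<Longrightarrow> cmod (cnj z * w) < 1"
  using mult_strict_mono'[of "cmod z" 1 "cmod w" 1] by (simp add: norm_mult)

lemma continuous_on_deriv_disc:
  "f holomorphic_on unit_disc \<Longrightarrow> continuous_on unit_disc (deriv f)"
  by (intro holomorphic_on_imp_continuous_on holomorphic_deriv) auto

lemma dirichlet_inner_commute: "dirichlet_inner \<alpha> g f = cnj (dirichlet_inner \<alpha> f g)"
proof -
  have "cnj (LINT z:unit_disc|lborel. deriv f z * cnj (deriv g z) * of_real ((1 - (cmod z)\<^sup>2) powr (1 - \<alpha>)))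
    = (LINT z:unit_disc|lborel. cnj (deriv f z * cnj (deriv g z) * of_real ((1 - (cmod z)\<^sup>2) powr (1 - \<alpha>))))"
    unfolding set_lebesgue_integral_def Bochner_Integration.integral_cnj[symmetric]
    by (simp del: Bochner_Integration.integral_cnj)
  then show ?thesis by (simp add: dirichlet_inner_def mult_ac)
qed

lemma dirichlet_norm_power2:
  "complex_of_real ((dirichlet_norm \<alpha> f)\<^sup>2) = dirichlet_inner \<alpha> f f"
proof -
  let ?I = "LINT z:unit_disc|lborel. (cmod (deriv f z))\<^sup>2 * (1 - (cmod z)\<^sup>2) powr (1 - \<alpha>)"
  have "?I \<ge> 0"
    unfolding set_lebesgue_integral_def by (intro integral_nonneg_AE) auto
  then have "complex_of_real ((dirichlet_norm \<alpha> f)\<^sup>2) = of_real ((cmod (f 0))\<^sup>2) + of_real ?I"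
    unfolding dirichlet_norm_def by (subst real_sqrt_pow2) auto
  also have "\<dots> = dirichlet_inner \<alpha> f f"
    unfolding dirichlet_inner_def set_integral_complex_of_real[symmetric]
    by (simp only: of_real_mult complex_norm_square mult_ac)
  finally show ?thesis .
qed

section \<open>The reproducing property and norms of kernel combinations\<close>

context
  fixes \<alpha> :: real
  assumes \<alpha>: "0 \<le> \<alpha>" "\<alpha> \<le> 1"
begin

lemma kernel_fun_deriv:
  assumes \<mu>: "\<mu> \<in> unit_disc" and z: "z \<in> unit_disc"
  shows "kernel_fun \<alpha> \<mu> field_differentiable (at z)"
    and "(\<lambda>n. of_nat (Suc n) * of_real (kernel_coeff \<alpha> (Suc n)) * cnj \<mu> ^ Suc n * z ^ n)
            sums deriv (kernel_fun \<alpha> \<mu>) z"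
proof -
  define c where "c = (\<lambda>n. complex_of_real (kernel_coeff \<alpha> n) * cnj \<mu> ^ n)"
  have c: "(\<lambda>n. c n * w ^ n) sums kernel_fun \<alpha> \<mu> w" if "norm w < 1" for w
    using kernel_series_sums[OF \<alpha> cmod_mult_disc[OF \<mu>, of w]] that
    by (simp add: c_def kernel_fun_def power_mult_distrib mult_ac)
  have z1: "norm z < 1" using z by simp
  have "((\<lambda>w. \<Sum>n. c n * w ^ n) has_field_derivative (\<Sum>n. diffs c n * z ^ n)) (at z)"
    by (rule termdiffs_strong'[of 1]) (use c z1 in \<open>auto intro: sums_summable\<close>)
  then have D: "(kernel_fun \<alpha> \<mu> has_field_derivative (\<Sum>n. diffs c n * z ^ n)) (at z)"
    by (rule has_field_derivative_transform_within_open[of _ _ _ unit_disc])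
       (use c z1 in \<open>auto dest: sums_unique[symmetric]\<close>)
  then show "kernel_fun \<alpha> \<mu> field_differentiable (at z)"
    using field_differentiable_def by blast
  have "(\<lambda>n. diffs c n * z ^ n) sums deriv (kernel_fun \<alpha> \<mu>) z"
    using termdiffs_sums_strong[OF c D z1] DERIV_imp_deriv[OF D] by simp
  then show "(\<lambda>n. of_nat (Suc n) * of_real (kernel_coeff \<alpha> (Suc n)) * cnj \<mu> ^ Suc n * z ^ n)
            sums deriv (kernel_fun \<alpha> \<mu>) z"
    by (simp add: diffs_def c_def mult_ac)
qed

lemma kernel_fun_holomorphic: "\<mu> \<in> unit_disc \<Longrightarrow> kernel_fun \<alpha> \<mu> holomorphic_on unit_disc"
  by (auto simp: holomorphic_on_open field_differentiable_def[symmetric] intro!: kernel_fun_deriv)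

text \<open>Here the variable z of the derivative series has its worst modulus, 1. As
  \<open>\<mu>\<close> lies inside the disc, the series converges uniformly on the whole disc, up to
  the boundary.\<close>

lemma summable_kernel_deriv_bound:
  assumes \<mu>: "\<mu> \<in> unit_disc"
  shows "summable (\<lambda>n. real (Suc n) * kernel_coeff \<alpha> (Suc n) * cmod \<mu> ^ Suc n)"
proof (rule summable_comparison_test')
  show "summable (\<lambda>n. real (Suc n) * cmod \<mu> ^ n)"
    using geometric_deriv_sums[of "cmod \<mu>"] \<mu> by (auto intro: sums_summable)
  fix n
  have "kernel_coeff \<alpha> (Suc n) * cmod \<mu> ^ Suc n \<le> 1 * cmod \<mu> ^ n"
    using kernel_coeff_le_1[OF \<alpha>] kernel_coeff_pos[OF \<alpha>(2)] \<mu>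
    by (intro mult_mono power_decreasing) (auto simp: less_imp_le)
  then have "real (Suc n) * (kernel_coeff \<alpha> (Suc n) * cmod \<mu> ^ Suc n) \<le> real (Suc n) * cmod \<mu> ^ n"
    by (intro mult_left_mono) auto
  moreover have "0 \<le> real (Suc n) * (kernel_coeff \<alpha> (Suc n) * cmod \<mu> ^ Suc n)"
    using kernel_coeff_pos[OF \<alpha>(2), of "Suc n"] by (intro mult_nonneg_nonneg) auto
  ultimately show "norm (real (Suc n) * kernel_coeff \<alpha> (Suc n) * cmod \<mu> ^ Suc n) \<le> real (Suc n) * cmod \<mu> ^ n"
    by (simp only: real_norm_def abs_of_nonneg mult.assoc)
qed

lemma kernel_fun_deriv_bounded:
  assumes \<mu>: "\<mu> \<in> unit_disc"
  obtains B where "\<And>z. z \<in> unit_disc \<Longrightarrow> cmod (deriv (kernel_fun \<alpha> \<mu>) z) \<le> B"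
proof
  fix z assume z: "z \<in> unit_disc"
  let ?f = "\<lambda>n. of_nat (Suc n) * of_real (kernel_coeff \<alpha> (Suc n)) * cnj \<mu> ^ Suc n * z ^ n"
  have le: "norm (?f n) \<le> real (Suc n) * kernel_coeff \<alpha> (Suc n) * cmod \<mu> ^ Suc n" for n
  proof -
    have "norm (?f n) = (real (Suc n) * kernel_coeff \<alpha> (Suc n) * cmod \<mu> ^ Suc n) * cmod z ^ n"
      unfolding norm_mult norm_power norm_of_nat norm_of_real complex_mod_cnj
      using kernel_coeff_pos[OF \<alpha>(2), of "Suc n"] by simp
    also have "\<dots> \<le> (real (Suc n) * kernel_coeff \<alpha> (Suc n) * cmod \<mu> ^ Suc n) * 1"
      using z kernel_coeff_pos[OF \<alpha>(2), of "Suc n"] by (intro mult_left_mono power_le_one) auto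
    finally show ?thesis by simp
  qed
  have "norm (\<Sum>n. ?f n) \<le> (\<Sum>n. real (Suc n) * kernel_coeff \<alpha> (Suc n) * cmod \<mu> ^ Suc n)"
    by (rule norm_suminf_le[OF le]) (rule summable_kernel_deriv_bound[OF \<mu>])
  then show "cmod (deriv (kernel_fun \<alpha> \<mu>) z) \<le> (\<Sum>n. real (Suc n) * kernel_coeff \<alpha> (Suc n) * cmod \<mu> ^ Suc n)"
    using sums_unique[OF kernel_fun_deriv(2)[OF \<mu> z]] by simp
qed

lemma in_dirichlet_spaceI:
  assumes "f holomorphic_on unit_disc" "\<And>z. z \<notin> unit_disc \<Longrightarrow> f z = 0"
    and B: "\<And>z. z \<in> unit_disc \<Longrightarrow> cmod (deriv f z) \<le> B"
  shows "f \<in> dirichlet_space \<alpha>"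
proof -
  have "set_integrable lborel unit_disc (\<lambda>z. (cmod (deriv f z))\<^sup>2 * dirichlet_weight \<alpha> z)"
  proof (rule set_integrable_continuous_on_bounded)
    show "continuous_on unit_disc (\<lambda>z. (cmod (deriv f z))\<^sup>2 * dirichlet_weight \<alpha> z)"
      by (intro continuous_intros continuous_on_deriv_disc assms continuous_on_dirichlet_weight)
    fix z assume z: "z \<in> unit_disc"
    show "norm ((cmod (deriv f z))\<^sup>2 * dirichlet_weight \<alpha> z) \<le> B\<^sup>2"
      using mult_mono[OF power_mono[OF B[OF z], of 2], of "dirichlet_weight \<alpha> z" 1]
        dirichlet_weight_bounds[OF \<alpha>(2) z] by (simp add: abs_mult)
  qed auto
  then show ?thesis using assms by (simp add: dirichlet_space_def dirichlet_weight_def)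
qed

lemma kernel_fun_in_dirichlet_space: "\<mu> \<in> unit_disc \<Longrightarrow> kernel_fun \<alpha> \<mu> \<in> dirichlet_space \<alpha>"
  by (metis kernel_fun_deriv_bounded kernel_fun_holomorphic in_dirichlet_spaceI kernel_fun_def)

text \<open>Follows from t \<le> t^2 + 1, since the weight has finite total mass.\<close>

lemma set_integrable_deriv_weight:
  assumes "f \<in> dirichlet_space \<alpha>"
  shows "set_integrable lborel unit_disc (\<lambda>z. deriv f z * of_real (dirichlet_weight \<alpha> z))"
proof (rule set_integrable_bound)
  have f: "f holomorphic_on unit_disc"
    "set_integrable lborel unit_disc (\<lambda>z. (cmod (deriv f z))\<^sup>2 * dirichlet_weight \<alpha> z)"
    using assms by (auto simp: dirichlet_space_def dirichlet_weight_def)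
  have "set_integrable lborel unit_disc (dirichlet_weight \<alpha>)"
    by (rule set_integrable_continuous_on_bounded[of _ _ 1])
       (use continuous_on_dirichlet_weight dirichlet_weight_bounds[OF \<alpha>(2)] in auto)
  with f(2) show "set_integrable lborel unit_disc
      (\<lambda>z. (cmod (deriv f z))\<^sup>2 * dirichlet_weight \<alpha> z + dirichlet_weight \<alpha> z)"
    by (rule set_integral_add)
  show "set_borel_measurable lborel unit_disc (\<lambda>z. deriv f z * of_real (dirichlet_weight \<alpha> z))"
    by (intro set_borel_measurable_continuous_on_open continuous_intros continuous_on_deriv_disc
        continuous_on_dirichlet_weight f) auto
  show "AE z in lborel. z \<in> unit_disc \<longrightarrow> norm (deriv f z * complex_of_real (dirichlet_weight \<alpha> z))
    \<le> norm ((cmod (deriv f z))\<^sup>2 * dirichlet_weight \<alpha> z + dirichlet_weight \<alpha> z)"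
  proof (intro always_eventually allI impI)
    fix z assume z: "z \<in> unit_disc"
    have "0 \<le> (cmod (deriv f z) - 1)\<^sup>2" by simp
    then have "2 * cmod (deriv f z) \<le> (cmod (deriv f z))\<^sup>2 + 1"
      by (simp add: power2_diff)
    then have "cmod (deriv f z) \<le> (cmod (deriv f z))\<^sup>2 + 1"
      using norm_ge_zero[of "deriv f z"] by linarith
    from mult_right_mono[OF this dirichlet_weight_bounds(1)[OF \<alpha>(2) z]]
    show "norm (deriv f z * complex_of_real (dirichlet_weight \<alpha> z))
      \<le> norm ((cmod (deriv f z))\<^sup>2 * dirichlet_weight \<alpha> z + dirichlet_weight \<alpha> z)"
      using dirichlet_weight_bounds[OF \<alpha>(2) z] by (simp add: norm_mult algebra_simps)
  qed
qed

text \<open>The kernel is expanded, not \<open>f\<close>: only its derivative series converges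
  uniformly on the disc. Each term extracts one Taylor coefficient of \<open>deriv f\<close>, and
  the normalization of the coefficients turns the result into the Taylor series of \<open>f\<close>
  at \<open>\<mu>\<close>.\<close>

lemma dirichlet_inner_kernel_fun:
  assumes f: "f \<in> dirichlet_space \<alpha>" and \<mu>: "\<mu> \<in> unit_disc"
  shows "dirichlet_inner \<alpha> f (kernel_fun \<alpha> \<mu>) = f \<mu>"
proof -
  have hol: "f holomorphic_on unit_disc" using f by (simp add: dirichlet_space_def)
  have hol': "deriv f holomorphic_on unit_disc" using hol by (intro holomorphic_deriv) auto
  define d where "d = (\<lambda>n. of_nat (Suc n) * complex_of_real (kernel_coeff \<alpha> (Suc n)) * \<mu> ^ Suc n)"
  let ?u = "\<lambda>z. deriv f z * complex_of_real (dirichlet_weight \<alpha> z)"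
  have nd: "cmod (d n) = real (Suc n) * kernel_coeff \<alpha> (Suc n) * cmod \<mu> ^ Suc n" for n
    unfolding d_def norm_mult norm_power norm_of_nat norm_of_real
    using kernel_coeff_pos[OF \<alpha>(2), of "Suc n"] by simp
  have "(\<lambda>n. LINT z:unit_disc|lborel. ?u z * (d n * cnj z ^ n)) sums
      (LINT z:unit_disc|lborel. ?u z * cnj (deriv (kernel_fun \<alpha> \<mu>) z))"
  proof (rule sums_set_lebesgue_integral_mult[where B = "\<lambda>n. cmod (d n)"])
    show "set_integrable lborel unit_disc ?u" by (rule set_integrable_deriv_weight[OF f])
    show "set_borel_measurable lborel unit_disc (\<lambda>z. ?u z * (d n * cnj z ^ n))" for n
      by (intro set_borel_measurable_continuous_on_open continuous_intros continuous_on_deriv_disc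
        continuous_on_dirichlet_weight hol) auto
    show "cmod (d n * cnj z ^ n) \<le> cmod (d n)" if "z \<in> unit_disc" for n z
      using that mult_left_mono[of "cmod z ^ n" 1 "cmod (d n)"]
      by (simp add: norm_mult norm_power power_le_one)
    show "summable (\<lambda>n. cmod (d n))"
      unfolding nd by (rule summable_kernel_deriv_bound[OF \<mu>])
    show "(\<lambda>n. d n * cnj z ^ n) sums cnj (deriv (kernel_fun \<alpha> \<mu>) z)" if "z \<in> unit_disc" for z
      using iffD2[OF sums_cnj kernel_fun_deriv(2)[OF \<mu> that]] by (simp add: d_def)
  qed
  moreover have "(LINT z:unit_disc|lborel. ?u z * (d n * cnj z ^ n)) =
      (deriv ^^ Suc n) f 0 / fact (Suc n) * \<mu> ^ Suc n" for n
  proof -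
    have "(LINT z:unit_disc|lborel. ?u z * (d n * cnj z ^ n)) =
      d n * (LINT z:unit_disc|lborel. deriv f z * cnj z ^ n * of_real (dirichlet_weight \<alpha> z))"
      by (simp add: mult_ac flip: set_integral_mult_right)
    also have "\<dots> = d n * ((deriv ^^ n) (deriv f) 0 / fact n * of_real (pi * Beta (real n + 1) (2 - \<alpha>)))"
      by (simp only: set_integral_monomial[OF \<alpha>(2) hol' set_integrable_deriv_weight[OF f]])
    also have "\<dots> = of_real (kernel_coeff \<alpha> (Suc n) * (real (Suc n))\<^sup>2 * (pi * Beta (real n + 1) (2 - \<alpha>)))
       * ((deriv ^^ n) (deriv f) 0 / fact (Suc n) * \<mu> ^ Suc n)"
      unfolding d_def of_real_mult of_real_power of_real_of_nat_eq
      by (simp add: field_simps power2_eq_square del: of_nat_Suc)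
    also have "\<dots> = (deriv ^^ Suc n) f 0 / fact (Suc n) * \<mu> ^ Suc n"
      unfolding kernel_coeff_moment[OF \<alpha>(2)] by (simp add: funpow_swap1 del: fact_Suc)
    finally show ?thesis .
  qed
  ultimately have "(\<lambda>n. (deriv ^^ Suc n) f 0 / fact (Suc n) * \<mu> ^ Suc n) sums
     (LINT z:unit_disc|lborel. ?u z * cnj (deriv (kernel_fun \<alpha> \<mu>) z))"
    by simp
  then have "(\<lambda>n. (deriv ^^ n) f 0 / fact n * \<mu> ^ n) sums
     ((LINT z:unit_disc|lborel. ?u z * cnj (deriv (kernel_fun \<alpha> \<mu>) z)) + f 0)"
    using sums_Suc_iff[of "\<lambda>n. (deriv ^^ n) f 0 / fact n * \<mu> ^ n"] by (simp del: fact_Suc)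
  then have "(LINT z:unit_disc|lborel. ?u z * cnj (deriv (kernel_fun \<alpha> \<mu>) z)) + f 0 = f \<mu>"
    using holomorphic_power_series[OF hol \<mu>] sums_unique2 by force
  then show ?thesis
    by (simp add: dirichlet_inner_def dirichlet_weight_def kernel_fun_def mult_ac add.commute)
qed

text \<open>For uniqueness, a second candidate \<open>k\<close> is evaluated at z by pairing it with
  the kernel at z; the reproducing property of \<open>k\<close> then evaluates that kernel at
  \<open>\<mu>\<close>.\<close>

lemma dirichlet_kernel_eq:
  assumes \<mu>: "\<mu> \<in> unit_disc"
  shows "dirichlet_kernel \<alpha> \<mu> = kernel_fun \<alpha> \<mu>"
  unfolding dirichlet_kernel_def
proof (rule the_equality)
  show "kernel_fun \<alpha> \<mu> \<in> dirichlet_space \<alpha> \<and>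
     (\<forall>f\<in>dirichlet_space \<alpha>. f \<mu> = dirichlet_inner \<alpha> f (kernel_fun \<alpha> \<mu>))"
    using \<mu> by (simp add: kernel_fun_in_dirichlet_space dirichlet_inner_kernel_fun)
  fix k assume k: "k \<in> dirichlet_space \<alpha> \<and> (\<forall>f\<in>dirichlet_space \<alpha>. f \<mu> = dirichlet_inner \<alpha> f k)"
  show "k = kernel_fun \<alpha> \<mu>"
  proof
    fix z show "k z = kernel_fun \<alpha> \<mu> z"
    proof (cases "z \<in> unit_disc")
      case False
      then show ?thesis using k by (simp add: dirichlet_space_def kernel_fun_def)
    next
      case z: True
      have "k z = dirichlet_inner \<alpha> k (kernel_fun \<alpha> z)"
        using k z by (simp add: dirichlet_inner_kernel_fun)
      also have "\<dots> = cnj (kernel_fun \<alpha> z \<mu>)"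
        using k z by (subst dirichlet_inner_commute) (simp add: kernel_fun_in_dirichlet_space)
      also have "\<dots> = kernel_fun \<alpha> \<mu> z"
        using z \<mu> kernel_series_cnj[OF \<alpha> cmod_mult_disc[OF z \<mu>]] by (simp add: kernel_fun_def mult.commute)
      finally show ?thesis .
    qed
  qed
qed

text \<open>Only the second argument of the inner product is expanded by linearity; the reproducing
  property evaluates the combination in the first argument at the points.\<close>

lemma dirichlet_norm_kernel_combination:
  assumes F: "finite F" and \<mu>: "\<And>n. n \<in> F \<Longrightarrow> \<mu> n \<in> unit_disc"
  shows "complex_of_real ((dirichlet_norm \<alpha> (\<lambda>z. \<Sum>n\<in>F. b n * kernel_fun \<alpha> (\<mu> n) z))\<^sup>2) =
    (\<Sum>i\<in>F. \<Sum>j\<in>F. b i * cnj (b j) * kernel_series \<alpha> (cnj (\<mu> i) * \<mu> j))"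
proof -
  define f where "f = (\<lambda>z. \<Sum>n\<in>F. b n * kernel_fun \<alpha> (\<mu> n) z)"
  have fd: "kernel_fun \<alpha> (\<mu> n) field_differentiable (at z)" if "n \<in> F" "z \<in> unit_disc" for n z
    using kernel_fun_deriv(1) \<mu> that by blast
  have df: "deriv f z = (\<Sum>n\<in>F. b n * deriv (kernel_fun \<alpha> (\<mu> n)) z)" if "z \<in> unit_disc" for z
  proof (rule DERIV_imp_deriv)
    show "(f has_field_derivative (\<Sum>n\<in>F. b n * deriv (kernel_fun \<alpha> (\<mu> n)) z)) (at z)"
      unfolding f_def
      by (intro DERIV_sum DERIV_cmult) (use fd that in \<open>auto simp: field_differentiable_derivI\<close>)
  qed
  have hol: "f holomorphic_on unit_disc"
    unfolding f_def by (intro holomorphic_intros kernel_fun_holomorphic \<mu>)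
  have "\<forall>n\<in>F. \<exists>B. \<forall>z\<in>unit_disc. cmod (deriv (kernel_fun \<alpha> (\<mu> n)) z) \<le> B"
    using kernel_fun_deriv_bounded \<mu> by metis
  then obtain B where B: "\<And>n z. n \<in> F \<Longrightarrow> z \<in> unit_disc \<Longrightarrow> cmod (deriv (kernel_fun \<alpha> (\<mu> n)) z) \<le> B n"
    by metis
  have f: "f \<in> dirichlet_space \<alpha>"
  proof (rule in_dirichlet_spaceI[OF hol])
    show "f z = 0" if "z \<notin> unit_disc" for z
      using that by (simp add: f_def kernel_fun_def)
    show "cmod (deriv f z) \<le> (\<Sum>n\<in>F. cmod (b n) * B n)" if "z \<in> unit_disc" for z
      unfolding df[OF that]
      by (intro order_trans[OF norm_sum] sum_mono) (use B that in \<open>auto simp: norm_mult intro!: mult_left_mono\<close>)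
  qed
  have int: "set_integrable lborel unit_disc (\<lambda>z. deriv f z * cnj (deriv (kernel_fun \<alpha> (\<mu> n)) z) * of_real (dirichlet_weight \<alpha> z))"
    if n: "n \<in> F" for n
  proof (rule set_integrable_bound)
    show "set_integrable lborel unit_disc (\<lambda>z. of_real (B n) * (deriv f z * of_real (dirichlet_weight \<alpha> z)))"
      by (intro set_integrable_mult_right set_integrable_deriv_weight f)
    show "set_borel_measurable lborel unit_disc (\<lambda>z. deriv f z * cnj (deriv (kernel_fun \<alpha> (\<mu> n)) z) * of_real (dirichlet_weight \<alpha> z))"
      by (intro set_borel_measurable_continuous_on_open continuous_intros continuous_on_deriv_disc
        continuous_on_dirichlet_weight hol kernel_fun_holomorphic \<mu> n) auto
    show "AE z in lborel. z \<in> unit_disc \<longrightarrow>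
       norm (deriv f z * cnj (deriv (kernel_fun \<alpha> (\<mu> n)) z) * of_real (dirichlet_weight \<alpha> z))
       \<le> norm (of_real (B n) * (deriv f z * of_real (dirichlet_weight \<alpha> z)))"
    proof (intro always_eventually allI impI)
      fix z assume z: "z \<in> unit_disc"
      have "cmod (deriv (kernel_fun \<alpha> (\<mu> n)) z) \<le> \<bar>B n\<bar>"
        using B[OF n z] by linarith
      from mult_right_mono[OF this, of "norm (deriv f z * of_real (dirichlet_weight \<alpha> z))"]
      show "norm (deriv f z * cnj (deriv (kernel_fun \<alpha> (\<mu> n)) z) * of_real (dirichlet_weight \<alpha> z))
       \<le> norm (of_real (B n) * (deriv f z * of_real (dirichlet_weight \<alpha> z)))"
        by (simp add: norm_mult mult_ac)
    qed
  qed
  have "(LINT z:unit_disc|lborel. deriv f z * cnj (deriv f z) * of_real (dirichlet_weight \<alpha> z))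
     = (LINT z:unit_disc|lborel. \<Sum>n\<in>F. cnj (b n) * (deriv f z * cnj (deriv (kernel_fun \<alpha> (\<mu> n)) z) * of_real (dirichlet_weight \<alpha> z)))"
  proof (rule set_lebesgue_integral_cong, simp, intro allI impI)
    fix z assume "z \<in> unit_disc"
    then have "cnj (deriv f z) = (\<Sum>n\<in>F. cnj (b n) * cnj (deriv (kernel_fun \<alpha> (\<mu> n)) z))"
      by (simp add: df)
    then show "deriv f z * cnj (deriv f z) * of_real (dirichlet_weight \<alpha> z) =
       (\<Sum>n\<in>F. cnj (b n) * (deriv f z * cnj (deriv (kernel_fun \<alpha> (\<mu> n)) z) * of_real (dirichlet_weight \<alpha> z)))"
      by (simp only: sum_distrib_left sum_distrib_right mult_ac)
  qed
  also have "\<dots> = (\<Sum>n\<in>F. LINT z:unit_disc|lborel. cnj (b n) * (deriv f z * cnj (deriv (kernel_fun \<alpha> (\<mu> n)) z) * of_real (dirichlet_weight \<alpha> z)))"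
    using int unfolding set_lebesgue_integral_def set_integrable_def scaleR_sum_right
    by (intro Bochner_Integration.integral_sum) (simp add: integrable_mult_right flip: mult_scaleR_right)
  finally have "(LINT z:unit_disc|lborel. deriv f z * cnj (deriv f z) * of_real (dirichlet_weight \<alpha> z))
    = (\<Sum>n\<in>F. cnj (b n) * (LINT z:unit_disc|lborel. deriv f z * cnj (deriv (kernel_fun \<alpha> (\<mu> n)) z) * of_real (dirichlet_weight \<alpha> z)))"
    by simp
  moreover have "f 0 * cnj (f 0) = (\<Sum>n\<in>F. cnj (b n) * (f 0 * cnj (kernel_fun \<alpha> (\<mu> n) 0)))"
    by (subst (2) f_def) (simp add: sum_distrib_left mult_ac)
  ultimately have "dirichlet_inner \<alpha> f f = (\<Sum>n\<in>F. cnj (b n) * dirichlet_inner \<alpha> f (kernel_fun \<alpha> (\<mu> n)))"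
    by (simp add: dirichlet_inner_def dirichlet_weight_def sum.distrib distrib_left)
  also have "\<dots> = (\<Sum>j\<in>F. cnj (b j) * f (\<mu> j))"
    using \<mu> f by (intro sum.cong) (auto simp: dirichlet_inner_kernel_fun)
  also have "\<dots> = (\<Sum>j\<in>F. \<Sum>i\<in>F. b i * cnj (b j) * kernel_series \<alpha> (cnj (\<mu> i) * \<mu> j))"
    using \<mu> by (auto simp: f_def kernel_fun_def sum_distrib_left mult_ac intro!: sum.cong)
  also have "\<dots> = (\<Sum>i\<in>F. \<Sum>j\<in>F. b i * cnj (b j) * kernel_series \<alpha> (cnj (\<mu> i) * \<mu> j))"
    by (rule sum.swap)
  finally show ?thesis
    unfolding dirichlet_norm_power2 f_def .
qed

end

section \<open>Colourings and matrices with nonnegative entries\<close>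

definition monochromatic :: "('a \<Rightarrow> 'b) \<Rightarrow> 'a set \<Rightarrow> bool" where
  "monochromatic c F \<longleftrightarrow> (\<forall>i\<in>F. \<forall>j\<in>F. c i = c j)"

text \<open>The colouring minimizes the weight of the monochromatic pairs: recolouring one vertex cannot
  decrease that weight, so its own class is the lightest one seen from it.\<close>

lemma monochromatic_cut:
  fixes w :: "'a \<Rightarrow> 'a \<Rightarrow> real"
  assumes S: "finite S" and r: "r > 0"
    and sym: "\<And>i j. w i j = w j i" and nonneg: "\<And>i j. w i j \<ge> 0" and diag: "\<And>i. w i i = 0"
  obtains c :: "'a \<Rightarrow> nat" where "\<And>i. c i < r"
    and "\<And>F i. F \<subseteq> S \<Longrightarrow> monochromatic c F \<Longrightarrow> i \<in> F \<Longrightarrow> real r * (\<Sum>j\<in>F. w i j) \<le> (\<Sum>j\<in>S. w i j)"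
proof -
  define E where "E = (\<lambda>c::'a \<Rightarrow> nat. \<Sum>i\<in>S. \<Sum>j\<in>S. if c i = c j then w i j else 0)"
  define X where "X = (S \<rightarrow>\<^sub>E {..<r})"
  have "finite X" unfolding X_def using S by (intro finite_PiE) auto
  moreover have "X \<noteq> {}" using r by (auto simp: X_def PiE_eq_empty_iff)
  ultimately obtain c where c: "c \<in> X" "\<And>d. d \<in> X \<Longrightarrow> E c \<le> E d"
    using arg_min_if_finite[of X E] by (metis leI)
  \<comment> \<open>Isolates the part of the energy that depends on the colour of i; the factor 2
    counts the ordered pairs (i, j) and (j, i).\<close>
  have split: "E d = (\<Sum>a\<in>S-{i}. \<Sum>b\<in>S-{i}. if d a = d b then w a b else 0)
      + 2 * (\<Sum>j\<in>S-{i}. if d j = d i then w i j else 0)" if i: "i \<in> S" for d i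
  proof -
    have row: "(\<Sum>b\<in>S. if d a = d b then w a b else 0) =
        (\<Sum>b\<in>S-{i}. if d a = d b then w a b else 0) + (if d a = d i then w a i else 0)" for a
      by (subst sum.remove[OF S i]) simp
    have "E d = (\<Sum>a\<in>S-{i}. \<Sum>b\<in>S. if d a = d b then w a b else 0) + (\<Sum>b\<in>S. if d i = d b then w i b else 0)"
      unfolding E_def by (subst sum.remove[OF S i]) simp
    also have "(\<Sum>b\<in>S. if d i = d b then w i b else 0) = (\<Sum>j\<in>S-{i}. if d j = d i then w i j else 0)"
      unfolding row[of i] by (simp add: diag eq_commute)
    also have "(\<Sum>a\<in>S-{i}. \<Sum>b\<in>S. if d a = d b then w a b else 0) =
       (\<Sum>a\<in>S-{i}. \<Sum>b\<in>S-{i}. if d a = d b then w a b else 0) + (\<Sum>j\<in>S-{i}. if d j = d i then w i j else 0)"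
      unfolding row sum.distrib by (intro arg_cong2[where f="(+)"] refl sum.cong if_cong sym)
    finally show ?thesis by simp
  qed
  have local: "(\<Sum>j\<in>S-{i}. if c j = c i then w i j else 0) \<le> (\<Sum>j\<in>S-{i}. if c j = k then w i j else 0)"
    if i: "i \<in> S" and k: "k < r" for i k
  proof -
    have "c(i := k) \<in> X" using c(1) i k by (auto simp: X_def PiE_def extensional_def)
    then have "E c \<le> E (c(i := k))" by (rule c(2))
    moreover have "(\<Sum>a\<in>S-{i}. \<Sum>b\<in>S-{i}. if (c(i := k)) a = (c(i := k)) b then w a b else 0)
       = (\<Sum>a\<in>S-{i}. \<Sum>b\<in>S-{i}. if c a = c b then w a b else 0)"
      by (intro sum.cong) auto
    moreover have "(\<Sum>j\<in>S-{i}. if (c(i := k)) j = (c(i := k)) i then w i j else 0)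
       = (\<Sum>j\<in>S-{i}. if c j = k then w i j else 0)"
      by (intro sum.cong) auto
    ultimately show ?thesis unfolding split[OF i] by linarith
  qed
  show ?thesis
  \<comment> \<open>Off \<open>S\<close> the function \<open>c\<close> is \<open>undefined\<close>;
    the value 0 keeps every colour below r.\<close>
  proof (rule that[of "\<lambda>i. if i \<in> S then c i else 0"])
    show "(if i \<in> S then c i else 0) < r" for i
      using c(1) r by (auto simp: X_def PiE_def Pi_def)
    fix F i assume F: "F \<subseteq> S" "monochromatic (\<lambda>i. if i \<in> S then c i else 0) F" and i: "i \<in> F"
    have iS: "i \<in> S" using F i by blast
    have mono: "c j = c i" if "j \<in> F" for j
      using F i that unfolding monochromatic_def by (metis subsetD)
    have "(\<Sum>j\<in>F. w i j) = (\<Sum>j\<in>F. if c j = c i then w i j else 0)"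
      using mono by (intro sum.cong) auto
    also have "\<dots> \<le> (\<Sum>j\<in>S. if c j = c i then w i j else 0)"
      using S F nonneg by (intro sum_mono2) auto
    also have "\<dots> = (\<Sum>j\<in>S-{i}. if c j = c i then w i j else 0)"
      using S iS by (simp add: sum.remove diag)
    finally have "real r * (\<Sum>j\<in>F. w i j) \<le> (\<Sum>k<r. \<Sum>j\<in>S-{i}. if c j = c i then w i j else 0)"
      by (simp add: mult_left_mono)
    also have "\<dots> \<le> (\<Sum>k<r. \<Sum>j\<in>S-{i}. if c j = k then w i j else 0)"
      by (rule sum_mono) (simp add: local[OF iS])
    also have "\<dots> = (\<Sum>j\<in>S-{i}. \<Sum>k<r. if c j = k then w i j else 0)"
      by (rule sum.swap)
    also have "\<dots> = (\<Sum>j\<in>S-{i}. w i j)"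
      using c(1) by (intro sum.cong) (auto simp: X_def PiE_def Pi_def sum.delta')
    also have "\<dots> = (\<Sum>j\<in>S. w i j)"
      using S iS by (simp add: sum.remove diag)
    finally show "real r * (\<Sum>j\<in>F. w i j) \<le> (\<Sum>j\<in>S. w i j)" .
  qed
qed

text \<open>A diagonal subsequence of the finite colourings converges at every index, and a
  convergent sequence of integers is eventually constant. A finite set meets only finitely many
  indices, so from some stage on it is coloured as in the limit.\<close>

lemma coloring_compactness:
  fixes Q :: "nat set \<Rightarrow> bool"
  assumes "\<And>N. \<exists>c::nat \<Rightarrow> nat. (\<forall>i. c i < r) \<and> (\<forall>F\<subseteq>{1..N}. monochromatic c F \<longrightarrow> Q F)"
  obtains c :: "nat \<Rightarrow> nat" where "\<And>i. c i < r"
    and "\<And>F. finite F \<Longrightarrow> F \<subseteq> {1..} \<Longrightarrow> monochromatic c F \<Longrightarrow> Q F"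
proof -
  obtain d :: "nat \<Rightarrow> nat \<Rightarrow> nat" where d: "\<And>N i. d N i < r"
    and Q: "\<And>N F. F \<subseteq> {1..N} \<Longrightarrow> monochromatic (d N) F \<Longrightarrow> Q F"
    using assms by metis
  have bnd: "norm (real (d n x)) \<le> real r" if "x \<in> UNIV" for n x
    using d[of n x] by simp
  obtain k :: "nat \<Rightarrow> nat" where k: "strict_mono k"
    and conv: "\<And>x. x \<in> UNIV \<Longrightarrow> \<exists>l. (\<lambda>n. real (d (k n) x)) \<longlonglongrightarrow> l"
    by (rule function_convergent_subsequence[of UNIV "\<lambda>n x. real (d n x)" "real r", OF countableI_type bnd])
       (rule UNIV_I, rule that, assumption, blast)
  have "\<exists>v M. \<forall>n\<ge>M. d (k n) x = v" for x
  proof -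
    have "Cauchy (\<lambda>n. real (d (k n) x))" using conv[of x] by (auto intro: LIMSEQ_imp_Cauchy)
    then obtain M where "\<And>m n. m \<ge> M \<Longrightarrow> n \<ge> M \<Longrightarrow> \<bar>real (d (k m) x) - real (d (k n) x)\<bar> < 1"
      unfolding Cauchy_def dist_real_def by (metis zero_less_one)
    then have "\<bar>real (d (k n) x) - real (d (k M) x)\<bar> < 1" if "n \<ge> M" for n
      using that by simp
    then have "d (k n) x = d (k M) x" if "n \<ge> M" for n
      using that by force
    then show ?thesis by blast
  qed
  then obtain c M where cM: "\<And>x n. n \<ge> M x \<Longrightarrow> d (k n) x = c x" by metis
  show ?thesis
  proof (rule that)
    show "c i < r" for i using cM[of i "M i"] d by (metis le_refl)
    fix F :: "nat set" assume F: "finite F" "F \<subseteq> {1..}" "monochromatic c F"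
    \<comment> \<open>Beyond the stabilization stages of all points of \<open>F\<close>, and beyond
      the points themselves so that \<open>F\<close> lies in the initial segment; the 0 covers the
      empty set.\<close>
    define n where "n = Max (insert 0 (M ` F \<union> F))"
    have n: "M x \<le> n" "x \<le> n" if "x \<in> F" for x
      using F(1) that by (auto simp: n_def)
    have "n \<le> k n" using k by (rule strict_mono_imp_increasing)
    then have "F \<subseteq> {1..k n}" using F(2) n by force
    moreover have "monochromatic (d (k n)) F"
    proof -
      have "d (k n) x = c x" if "x \<in> F" for x
        using n(1)[OF that] by (rule cM)
      then show ?thesis using F(3) unfolding monochromatic_def by metis
    qed
    ultimately show "Q F" by (rule Q)
  qed
qed

text \<open>Polarization at x + t A x: the cross terms give 2 t times the squared norm of A x, and
  the remaining terms are nonnegative because all entries and coefficients are.\<close>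

lemma nonneg_form_imp_norm_bound:
  fixes A :: "'a \<Rightarrow> 'a \<Rightarrow> real"
  assumes S: "finite S" and M: "M > 0"
    and sym: "\<And>i j. A i j = A j i" and nonneg: "\<And>i j. A i j \<ge> 0"
    and form: "\<And>x. (\<And>i. x i \<ge> 0) \<Longrightarrow> (\<Sum>i\<in>S. \<Sum>j\<in>S. A i j * x i * x j) \<le> M * (\<Sum>i\<in>S. (x i)\<^sup>2)"
    and x: "\<And>i. x i \<ge> 0"
  shows "(\<Sum>i\<in>S. (\<Sum>j\<in>S. A i j * x j)\<^sup>2) \<le> 4 * M\<^sup>2 * (\<Sum>i\<in>S. (x i)\<^sup>2)"
proof -
  define y where "y = (\<lambda>i. \<Sum>j\<in>S. A i j * x j)"
  \<comment> \<open>With this t the term 2 M t^2 ?Y on the right absorbs exactly half of 2 t ?Y on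
    the left.\<close>
  define t where "t = 1 / (2 * M)"
  let ?X = "\<Sum>i\<in>S. (x i)\<^sup>2" and ?Y = "\<Sum>i\<in>S. (y i)\<^sup>2"
  have y: "y i \<ge> 0" for i unfolding y_def using nonneg x by (intro sum_nonneg) auto
  have t: "t > 0" using M by (simp add: t_def)
  have "2 * t * ?Y = t * (\<Sum>i\<in>S. \<Sum>j\<in>S. A i j * y i * x j) + t * (\<Sum>i\<in>S. \<Sum>j\<in>S. A i j * x i * y j)"
  proof -
    have "(\<Sum>i\<in>S. \<Sum>j\<in>S. A i j * y i * x j) = ?Y"
      by (simp add: y_def power2_eq_square sum_distrib_left mult_ac)
    moreover have "(\<Sum>i\<in>S. \<Sum>j\<in>S. A i j * x i * y j) = (\<Sum>i\<in>S. \<Sum>j\<in>S. A i j * y i * x j)"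
      by (subst sum.swap) (simp add: sym mult_ac)
    ultimately show ?thesis by simp
  qed
  also have "\<dots> \<le> (\<Sum>i\<in>S. \<Sum>j\<in>S. A i j * (x i + t * y i) * (x j + t * y j))"
    unfolding sum_distrib_left sum.distrib[symmetric]
  proof (intro sum_mono)
    fix i j
    have "0 \<le> A i j * (x i * x j) + A i j * (t * y i * (t * y j))"
      using nonneg x y t by (intro add_nonneg_nonneg mult_nonneg_nonneg) auto
    then show "t * (A i j * y i * x j) + t * (A i j * x i * y j) \<le> A i j * (x i + t * y i) * (x j + t * y j)"
      by (simp add: algebra_simps)
  qed
  also have "\<dots> \<le> M * (\<Sum>i\<in>S. (x i + t * y i)\<^sup>2)"
    using form[of "\<lambda>i. x i + t * y i"] x y t by (simp add: less_imp_le)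
  also have "\<dots> \<le> M * (2 * ?X + 2 * t\<^sup>2 * ?Y)"
  proof (intro mult_left_mono)
    have "(x i + t * y i)\<^sup>2 \<le> 2 * (x i)\<^sup>2 + 2 * t\<^sup>2 * (y i)\<^sup>2" for i
      using zero_le_power2[of "x i - t * y i"]
      by (simp add: power2_eq_square algebra_simps)
    then show "(\<Sum>i\<in>S. (x i + t * y i)\<^sup>2) \<le> 2 * ?X + 2 * t\<^sup>2 * ?Y"
      unfolding sum_distrib_left sum.distrib[symmetric] by (intro sum_mono) auto
  qed (use M in auto)
  finally have "?Y \<le> 4 * M\<^sup>2 * ?X"
    using M unfolding t_def by (simp add: field_simps power2_eq_square)
  then show ?thesis by (simp only: y_def)
qed

text \<open>The vector is a truncated Neumann series \<open>\<Sum>k\<le>n. A\<^sup>k 1 / (4 M)\<^sup>k\<close> with \<open>n\<close> so large that the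
  next term is at most \<open>1\<close>, the constant term of the series.\<close>

lemma nonneg_form_imp_supersolution:
  fixes A :: "'a \<Rightarrow> 'a \<Rightarrow> real"
  assumes S: "finite S" and M: "M > 0"
    and sym: "\<And>i j. A i j = A j i" and nonneg: "\<And>i j. A i j \<ge> 0"
    and form: "\<And>x. (\<And>i. x i \<ge> 0) \<Longrightarrow> (\<Sum>i\<in>S. \<Sum>j\<in>S. A i j * x i * x j) \<le> M * (\<Sum>i\<in>S. (x i)\<^sup>2)"
  obtains p where "\<And>i. p i > 0" "\<And>i. i \<in> S \<Longrightarrow> (\<Sum>j\<in>S. A i j * p j) \<le> 4 * M * p i"
proof -
  define T where "T = (\<lambda>x i. \<Sum>j\<in>S. A i j * x j)"
  define v where "v = (\<lambda>k. (T ^^ k) (\<lambda>_. 1::real))"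
  define n where "n = card S"
  define p where "p = (\<lambda>i. \<Sum>k\<le>n. v k i / (4 * M) ^ k)"
  have v0: "v 0 i = 1" and vS: "v (Suc k) i = (\<Sum>j\<in>S. A i j * v k j)" for k i
    by (simp_all add: v_def T_def)
  have v: "v k i \<ge> 0" for k i
    by (induction k arbitrary: i) (use nonneg in \<open>auto simp: v0 vS intro!: sum_nonneg\<close>)
  have bound: "(\<Sum>i\<in>S. (v k i)\<^sup>2) \<le> (4 * M\<^sup>2) ^ k * real (card S)" for k
  proof (induction k)
    case (Suc k)
    have "(\<Sum>i\<in>S. (v (Suc k) i)\<^sup>2) \<le> 4 * M\<^sup>2 * (\<Sum>i\<in>S. (v k i)\<^sup>2)"
      unfolding vS by (intro nonneg_form_imp_norm_bound S M sym nonneg form v)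
    also have "\<dots> \<le> 4 * M\<^sup>2 * ((4 * M\<^sup>2) ^ k * real (card S))"
      by (intro mult_left_mono Suc) auto
    finally show ?case by simp
  qed (simp add: v0)
  \<comment> \<open>By \<open>bound\<close>, k steps cost at most (2 M)^k in norm. Division by 4 M
    gains a factor 2 per step, which outweighs the square root of \<open>card S\<close> after
    \<open>card S\<close> steps.\<close>
  have last: "v (Suc n) i \<le> (4 * M) ^ Suc n" if i: "i \<in> S" for i
  proof (rule power2_le_imp_le)
    have "(v (Suc n) i)\<^sup>2 \<le> (\<Sum>i\<in>S. (v (Suc n) i)\<^sup>2)"
      using S i by (intro member_le_sum) auto
    also have "\<dots> \<le> (4 * M\<^sup>2) ^ Suc n * real (card S)" by (rule bound)
    also have "\<dots> \<le> (4 * M\<^sup>2) ^ Suc n * 4 ^ Suc n"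
    proof (intro mult_left_mono)
      have "card S < 2 ^ n" unfolding n_def by (rule less_exp)
      then have "real (card S) \<le> 2 ^ n" by (metis less_imp_le of_nat_le_iff of_nat_numeral of_nat_power)
      also have "(2::real) ^ n \<le> 4 ^ n" by (intro power_mono) auto
      also have "(4::real) ^ n \<le> 4 ^ Suc n" by simp
      finally show "real (card S) \<le> 4 ^ Suc n" .
    qed (use M in auto)
    also have "\<dots> = ((4 * M) ^ Suc n)\<^sup>2"
    proof -
      have "((4 * M) ^ Suc n)\<^sup>2 = ((4 * M)\<^sup>2) ^ Suc n"
        by (metis mult.commute power_mult)
      also have "(4 * M)\<^sup>2 = 4 * M\<^sup>2 * 4" by (simp add: power_mult_distrib)
      finally show ?thesis by (simp only: power_mult_distrib)
    qed
    finally show "(v (Suc n) i)\<^sup>2 \<le> ((4 * M) ^ Suc n)\<^sup>2" .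
  qed (use M in auto)
  show ?thesis
  proof (rule that[of p])
    show "p i > 0" for i
    proof -
      have "v 0 i / (4 * M) ^ 0 \<le> p i"
        unfolding p_def by (rule member_le_sum) (use v M in auto)
      then show ?thesis by (simp add: v0)
    qed
    fix i assume i: "i \<in> S"
    have "(\<Sum>j\<in>S. A i j * p j) = (\<Sum>k\<le>n. \<Sum>j\<in>S. A i j * v k j / (4 * M) ^ k)"
      unfolding p_def sum_distrib_left by (subst sum.swap) simp
    also have "\<dots> = (\<Sum>k\<le>n. v (Suc k) i / (4 * M) ^ k)"
      by (simp add: vS sum_divide_distrib)
    also have "\<dots> = 4 * M * (\<Sum>k\<le>n. v (Suc k) i / (4 * M) ^ Suc k)"
      using M by (simp add: sum_distrib_left)
    also have "(\<Sum>k\<le>n. v (Suc k) i / (4 * M) ^ Suc k) = (\<Sum>k\<le>Suc n. v k i / (4 * M) ^ k) - 1"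
      using sum.atMost_Suc_shift[of "\<lambda>k. v k i / (4 * M) ^ k" n] by (simp add: v0 del: sum.atMost_Suc)
    also have "\<dots> = p i + v (Suc n) i / (4 * M) ^ Suc n - 1"
      by (simp add: p_def)
    also have "4 * M * \<dots> \<le> 4 * M * p i"
      using last[OF i] M by (intro mult_left_mono) (auto simp: divide_le_eq)
    finally show "(\<Sum>j\<in>S. A i j * p j) \<le> 4 * M * p i" .
  qed
qed

text \<open>The threshold 8 M is twice the constant 4 M of the supersolution: the cut divides
  weighted row sums by r, which leaves at most half of \<open>p i\<close>.\<close>

lemma nonneg_matrix_paving:
  fixes A :: "'a \<Rightarrow> 'a \<Rightarrow> real"
  assumes S: "finite S" and M: "M > 0"
    and sym: "\<And>i j. A i j = A j i" and nonneg: "\<And>i j. A i j \<ge> 0" and diag: "\<And>i. A i i = 0"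
    and form: "\<And>x. (\<And>i. x i \<ge> 0) \<Longrightarrow> (\<Sum>i\<in>S. \<Sum>j\<in>S. A i j * x i * x j) \<le> M * (\<Sum>i\<in>S. (x i)\<^sup>2)"
    and r: "8 * M \<le> real r"
  obtains c :: "'a \<Rightarrow> nat" where "\<And>i. c i < r"
    and "\<And>F x. F \<subseteq> S \<Longrightarrow> monochromatic c F \<Longrightarrow>
           (\<Sum>i\<in>F. \<Sum>j\<in>F. A i j * x i * x j) \<le> 1 / 2 * (\<Sum>i\<in>F. (x i)\<^sup>2)"
proof -
  obtain p where p: "\<And>i. p i > 0" "\<And>i. i \<in> S \<Longrightarrow> (\<Sum>j\<in>S. A i j * p j) \<le> 4 * M * p i"
    using nonneg_form_imp_supersolution[OF S M sym nonneg form] by metis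
  have r0: "r > 0" using M r by (cases r) auto
  obtain c where c: "\<And>i. c i < r"
    "\<And>F i. F \<subseteq> S \<Longrightarrow> monochromatic c F \<Longrightarrow> i \<in> F \<Longrightarrow>
       real r * (\<Sum>j\<in>F. p i * A i j * p j) \<le> (\<Sum>j\<in>S. p i * A i j * p j)"
    by (rule monochromatic_cut[OF S r0, of "\<lambda>i j. p i * A i j * p j"])
       (use p nonneg sym in \<open>auto simp: diag mult_ac less_imp_le\<close>)
  show ?thesis
  proof (rule that[OF c(1)])
    fix F x assume F: "F \<subseteq> S" "monochromatic c F"
    have row: "(\<Sum>j\<in>F. A i j * p j) \<le> p i / 2" if i: "i \<in> F" for i
    proof -
      have "real r * (p i * (\<Sum>j\<in>F. A i j * p j)) \<le> p i * (\<Sum>j\<in>S. A i j * p j)"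
        using c(2)[OF F i] by (simp add: sum_distrib_left mult_ac)
      also have "\<dots> \<le> p i * (4 * M * p i)"
        using p F i by (intro mult_left_mono) (auto simp: less_imp_le)
      finally have "real r * (\<Sum>j\<in>F. A i j * p j) \<le> 4 * M * p i"
        using p(1)[of i] by (simp add: mult.left_commute[of _ "p i"])
      also have "\<dots> \<le> real r / 2 * p i"
        using r p(1)[of i] by (intro mult_right_mono) auto
      finally have "real r * (\<Sum>j\<in>F. A i j * p j) \<le> real r * (p i / 2)" by simp
      then show ?thesis using r0 by simp
    qed
    have "(\<Sum>i\<in>F. \<Sum>j\<in>F. A i j * x i * x j)
       \<le> (\<Sum>i\<in>F. \<Sum>j\<in>F. 1 / 2 * (A i j * p j * ((x i)\<^sup>2 / p i)) + 1 / 2 * (A j i * p i * ((x j)\<^sup>2 / p j)))"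
    proof (intro sum_mono)
      fix i j
      \<comment> \<open>Weighted arithmetic-geometric mean. The weights are placed so that
        multiplying by A and summing produces the row sums bounded in \<open>row\<close>.\<close>
      have "0 \<le> (x i * p j - x j * p i)\<^sup>2 / (p i * p j)"
        using p(1)[of i] p(1)[of j] by simp
      also have "\<dots> = p j * ((x i)\<^sup>2 / p i) + p i * ((x j)\<^sup>2 / p j) - 2 * (x i * x j)"
        using p(1)[of i] p(1)[of j] by (simp add: power2_eq_square field_simps)
      finally have "x i * x j \<le> 1 / 2 * (p j * ((x i)\<^sup>2 / p i)) + 1 / 2 * (p i * ((x j)\<^sup>2 / p j))"
        by simp
      from mult_left_mono[OF this nonneg[of i j]]
      show "A i j * x i * x j \<le> 1 / 2 * (A i j * p j * ((x i)\<^sup>2 / p i)) + 1 / 2 * (A j i * p i * ((x j)\<^sup>2 / p j))"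
        unfolding sym[of j i] by (simp add: algebra_simps)
    qed
    also have "\<dots> = (\<Sum>i\<in>F. \<Sum>j\<in>F. A i j * p j * ((x i)\<^sup>2 / p i))"
    proof -
      have "(\<Sum>i\<in>F. \<Sum>j\<in>F. A j i * p i * ((x j)\<^sup>2 / p j)) = (\<Sum>i\<in>F. \<Sum>j\<in>F. A i j * p j * ((x i)\<^sup>2 / p i))"
        by (rule sum.swap)
      then show ?thesis by (simp only: sum.distrib sum_distrib_left[symmetric])
    qed
    also have "\<dots> = (\<Sum>i\<in>F. (\<Sum>j\<in>F. A i j * p j) * ((x i)\<^sup>2 / p i))"
      by (simp only: sum_distrib_right)
    also have "\<dots> \<le> (\<Sum>i\<in>F. p i / 2 * ((x i)\<^sup>2 / p i))"
      using row p(1) by (intro sum_mono mult_right_mono) (auto simp: less_imp_le)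
    also have "\<dots> = 1 / 2 * (\<Sum>i\<in>F. (x i)\<^sup>2)"
    proof -
      have "p i / 2 * ((x i)\<^sup>2 / p i) = 1 / 2 * (x i)\<^sup>2" for i
        using p(1)[of i] by simp
      then show ?thesis by (simp only: sum_distrib_left)
    qed
    finally show "(\<Sum>i\<in>F. \<Sum>j\<in>F. A i j * x i * x j) \<le> 1 / 2 * (\<Sum>i\<in>F. (x i)\<^sup>2)" .
  qed
qed

section \<open>Szego kernels and Cauchy matrices\<close>

text \<open>If \<open>g i j\<close> is the inner product of the i-th with the j-th vector, this is
  the squared norm of the combination with coefficients \<open>x\<close>.\<close>

definition gram_form :: "('a \<Rightarrow> 'a \<Rightarrow> complex) \<Rightarrow> 'a set \<Rightarrow> ('a \<Rightarrow> complex) \<Rightarrow> complex" where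
  "gram_form g F x = (\<Sum>i\<in>F. \<Sum>j\<in>F. x i * cnj (x j) * g i j)"

text \<open>For a positive matrix, \<open>G \<le> C\<close> implies \<open>G\<^sup>2 \<le> C G\<close>: evaluate the form at \<open>x - G x / C\<close>.\<close>

lemma gram_form_bound_imp_norm_bound:
  assumes herm: "\<And>i j. g j i = cnj (g i j)" and C: "C > 0"
    and lower: "\<And>x. 0 \<le> Re (gram_form g F x)"
    and upper: "\<And>x. Re (gram_form g F x) \<le> C * (\<Sum>i\<in>F. (cmod (x i))\<^sup>2)"
  shows "(\<Sum>j\<in>F. (cmod (\<Sum>i\<in>F. x i * g i j))\<^sup>2) \<le> C * Re (gram_form g F x)"
proof -
  define y where "y = (\<lambda>j. \<Sum>i\<in>F. x i * g i j)"
  define t where "t = 1 / C"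
  let ?Y = "\<Sum>j\<in>F. (cmod (y j))\<^sup>2"
  have xy: "(\<Sum>i\<in>F. \<Sum>j\<in>F. x i * cnj (y j) * g i j) = of_real ?Y"
  proof -
    have "x i * cnj (y j) * g i j = cnj (y j) * (x i * g i j)" for i j
      by simp
    then have "(\<Sum>i\<in>F. \<Sum>j\<in>F. x i * cnj (y j) * g i j) = (\<Sum>j\<in>F. cnj (y j) * y j)"
      by (subst sum.swap) (simp only: y_def sum_distrib_left)
    then show ?thesis
      by (simp only: of_real_sum complex_norm_square mult.commute)
  qed
  have "(\<Sum>i\<in>F. \<Sum>j\<in>F. y i * cnj (x j) * g i j) = cnj (\<Sum>i\<in>F. \<Sum>j\<in>F. x i * cnj (y j) * g i j)"
    by (subst sum.swap) (simp add: herm[symmetric] mult_ac)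
  then have yx: "(\<Sum>i\<in>F. \<Sum>j\<in>F. y i * cnj (x j) * g i j) = of_real ?Y"
    unfolding xy by simp
  have "gram_form g F (\<lambda>i. x i - of_real t * y i) = gram_form g F x
     - of_real t * (\<Sum>i\<in>F. \<Sum>j\<in>F. x i * cnj (y j) * g i j)
     - of_real t * (\<Sum>i\<in>F. \<Sum>j\<in>F. y i * cnj (x j) * g i j) + of_real (t\<^sup>2) * gram_form g F y"
    unfolding gram_form_def sum_distrib_left sum_subtractf[symmetric] sum.distrib[symmetric]
    by (intro sum.cong refl) (simp add: algebra_simps power2_eq_square)
  then have "Re (gram_form g F (\<lambda>i. x i - of_real t * y i)) =
     Re (gram_form g F x) - 2 * t * ?Y + t\<^sup>2 * Re (gram_form g F y)"
    unfolding xy yx by simp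
  also have "\<dots> \<le> Re (gram_form g F x) - 2 * t * ?Y + t\<^sup>2 * (C * ?Y)"
    using upper[of y] by (intro add_left_mono mult_left_mono) auto
  also have "\<dots> = Re (gram_form g F x) - ?Y / C"
    using C by (simp add: t_def power2_eq_square field_simps)
  finally have "?Y / C \<le> Re (gram_form g F x)"
    using lower[of "\<lambda>i. x i - of_real t * y i"] by linarith
  then show ?thesis using C by (simp add: y_def field_simps)
qed

text \<open>Each monomial contributes a form of rank one. Positivity and comparison of such forms
  thereby reduce to statements about the coefficients \<open>c n\<close>.\<close>

lemma gram_form_sums:
  fixes c :: "nat \<Rightarrow> real" and \<phi> :: "complex \<Rightarrow> complex"
  assumes F: "finite F"
    and sums: "\<And>i j. i \<in> F \<Longrightarrow> j \<in> F \<Longrightarrow>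
      (\<lambda>n. of_real (c n) * (cnj (\<mu> i) * \<mu> j) ^ n) sums \<phi> (cnj (\<mu> i) * \<mu> j)"
  shows "(\<lambda>n. c n * (cmod (\<Sum>i\<in>F. x i * cnj (\<mu> i) ^ n))\<^sup>2) sums
      Re (gram_form (\<lambda>i j. \<phi> (cnj (\<mu> i) * \<mu> j)) F x)"
proof -
  have "(\<lambda>n. \<Sum>i\<in>F. \<Sum>j\<in>F. x i * cnj (x j) * (of_real (c n) * (cnj (\<mu> i) * \<mu> j) ^ n)) sums
      gram_form (\<lambda>i j. \<phi> (cnj (\<mu> i) * \<mu> j)) F x"
    unfolding gram_form_def by (intro sums_sum sums_mult sums)
  moreover have "(\<Sum>i\<in>F. \<Sum>j\<in>F. x i * cnj (x j) * (of_real (c n) * (cnj (\<mu> i) * \<mu> j) ^ n)) =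
      complex_of_real (c n * (cmod (\<Sum>i\<in>F. x i * cnj (\<mu> i) ^ n))\<^sup>2)" for n
    unfolding of_real_mult complex_norm_square cnj_sum sum_product
    by (simp add: sum_distrib_left power_mult_distrib mult_ac)
  ultimately show ?thesis using sums_Re by fastforce
qed

text \<open>Lagrange interpolation of \<open>\<Prod>l. 1 - w l * x\<close> at the nodes \<open>\<nu> j\<close>, evaluated at \<open>1 / v\<close> and multiplied by
  \<open>v ^ (card F - 1)\<close>; in this form it persists at \<open>v = 0\<close>.\<close>

lemma lagrange_homogeneous_nonzero:
  fixes \<nu> w :: "'a \<Rightarrow> complex"
  assumes F: "finite F" "inj_on \<nu> F" and k: "k \<in> F" and v: "v \<noteq> 0"
  shows "(\<Sum>j\<in>F. (\<Prod>l\<in>F-{k}. 1 - w l * \<nu> j) * (\<Prod>l\<in>F-{j}. (1 - v * \<nu> l) / (\<nu> j - \<nu> l))) = (\<Prod>l\<in>F-{k}. v - w l)"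
proof -
  define N where "N = card F"
  have N: "N > 0" using F k by (auto simp: N_def card_gt_0_iff)
  define Q where "Q = (\<Prod>l\<in>F-{k}. [:1, - w l:])"
  define L where "L = (\<Sum>j\<in>F. smult (poly Q (\<nu> j) / (\<Prod>l\<in>F-{j}. \<nu> j - \<nu> l)) (\<Prod>l\<in>F-{j}. [:- \<nu> l, 1:]))"
  have degQ: "degree Q < N"
  proof -
    have "degree Q \<le> sum (degree \<circ> (\<lambda>l. [:1, - w l:])) (F-{k})"
      unfolding Q_def using F by (intro degree_prod_sum_le) auto
    also have "\<dots> \<le> (\<Sum>l\<in>F-{k}. 1)" by (intro sum_mono) simp
    also have "\<dots> < N" using F k N by (simp add: N_def)
    finally show ?thesis .
  qed
  have degL: "degree L < N"
  proof -
    have "degree L \<le> N - 1"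
      unfolding L_def
    proof (rule degree_sum_le)
      fix j assume j: "j \<in> F"
      have "degree (\<Prod>l\<in>F-{j}. [:- \<nu> l, 1:]) \<le> sum (degree \<circ> (\<lambda>l. [:- \<nu> l, 1:])) (F-{j})"
        using F by (intro degree_prod_sum_le) auto
      also have "\<dots> = N - 1" using F j by (simp add: N_def)
      finally show "degree (smult (poly Q (\<nu> j) / (\<Prod>l\<in>F-{j}. \<nu> j - \<nu> l)) (\<Prod>l\<in>F-{j}. [:- \<nu> l, 1:])) \<le> N - 1"
        using degree_smult_le order_trans by blast
    qed (use F in auto)
    then show ?thesis using N by simp
  qed
  have eval: "poly L (\<nu> i) = poly Q (\<nu> i)" if i: "i \<in> F" for i
  proof -
    have nz: "(\<Prod>l\<in>F-{i}. \<nu> i - \<nu> l) \<noteq> 0"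
      using F i by (auto simp: inj_on_def)
    have "poly L (\<nu> i) = (\<Sum>j\<in>F. poly Q (\<nu> j) / (\<Prod>l\<in>F-{j}. \<nu> j - \<nu> l) * (\<Prod>l\<in>F-{j}. \<nu> i - \<nu> l))"
      by (simp add: L_def poly_sum poly_prod)
    also have "\<dots> = (\<Sum>j\<in>F. if j = i then poly Q (\<nu> i) else 0)"
      using F i nz by (intro sum.cong) auto
    also have "\<dots> = poly Q (\<nu> i)" using F i by simp
    finally show ?thesis .
  qed
  have "Q = L"
    by (rule poly_eqI_degree[of "\<nu> ` F"])
       (use eval degQ degL F in \<open>auto simp: card_image N_def\<close>)
  then have "poly Q (1 / v) = poly L (1 / v)" by simp
  then have "v ^ (N - 1) * poly Q (1 / v) = v ^ (N - 1) * poly L (1 / v)" by simp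
  moreover have "v ^ (N - 1) * poly Q (1 / v) = (\<Prod>l\<in>F-{k}. v - w l)"
  proof -
    have "v ^ (N - 1) = (\<Prod>l\<in>F-{k}. v)" using F k by (simp add: N_def)
    then have "v ^ (N - 1) * poly Q (1 / v) = (\<Prod>l\<in>F-{k}. v * (1 - w l / v))"
      by (simp add: Q_def poly_prod prod.distrib)
    also have "\<dots> = (\<Prod>l\<in>F-{k}. v - w l)"
      using v by (intro prod.cong) (auto simp: field_simps)
    finally show ?thesis .
  qed
  moreover have "v ^ (N - 1) * poly L (1 / v) =
     (\<Sum>j\<in>F. (\<Prod>l\<in>F-{k}. 1 - w l * \<nu> j) * (\<Prod>l\<in>F-{j}. (1 - v * \<nu> l) / (\<nu> j - \<nu> l)))"
    unfolding L_def poly_sum sum_distrib_left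
  proof (intro sum.cong refl)
    fix j assume j: "j \<in> F"
    have "v ^ (N - 1) = (\<Prod>l\<in>F-{j}. v)" using F j by (simp add: N_def)
    moreover have "(\<Prod>l\<in>F-{j}. v) * (\<Prod>l\<in>F-{j}. 1 / v - \<nu> l) = (\<Prod>l\<in>F-{j}. 1 - v * \<nu> l)"
      unfolding prod.distrib[symmetric] using v by (intro prod.cong) (auto simp: field_simps)
    ultimately have "v ^ (N - 1) * (\<Prod>l\<in>F-{j}. 1 / v - \<nu> l) = (\<Prod>l\<in>F-{j}. 1 - v * \<nu> l)" by simp
    then show "v ^ (N - 1) * poly (smult (poly Q (\<nu> j) / (\<Prod>l\<in>F-{j}. \<nu> j - \<nu> l)) (\<Prod>l\<in>F-{j}. [:- \<nu> l, 1:])) (1 / v)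
      = (\<Prod>l\<in>F-{k}. 1 - w l * \<nu> j) * (\<Prod>l\<in>F-{j}. (1 - v * \<nu> l) / (\<nu> j - \<nu> l))"
      by (simp add: Q_def poly_prod prod_dividef mult_ac)
  qed
  ultimately show ?thesis by (simp only:)
qed

text \<open>Both sides are continuous in v. The value v = 0 must be included because v will be the
  conjugate of a node, and a node may be the origin.\<close>

lemma lagrange_homogeneous:
  fixes \<nu> w :: "'a \<Rightarrow> complex"
  assumes F: "finite F" "inj_on \<nu> F" and k: "k \<in> F"
  shows "(\<Sum>j\<in>F. (\<Prod>l\<in>F-{k}. 1 - w l * \<nu> j) * (\<Prod>l\<in>F-{j}. (1 - v * \<nu> l) / (\<nu> j - \<nu> l))) = (\<Prod>l\<in>F-{k}. v - w l)"
proof (cases "v = 0")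
  case True
  let ?L = "\<lambda>v. \<Sum>j\<in>F. (\<Prod>l\<in>F-{k}. 1 - w l * \<nu> j) * (\<Prod>l\<in>F-{j}. (1 - v * \<nu> l) / (\<nu> j - \<nu> l))"
  let ?R = "\<lambda>v. \<Prod>l\<in>F-{k}. v - w l"
  have "\<nu> j \<noteq> \<nu> l" if "j \<in> F" "l \<in> F - {j}" for j l
    using F that by (auto simp: inj_on_def)
  then have L: "(?L \<longlongrightarrow> ?L 0) (at 0)"
    by (intro tendsto_intros) auto
  have "eventually (\<lambda>v. ?L v = ?R v) (at 0)"
    using lagrange_homogeneous_nonzero[OF F k] by (auto simp: eventually_at_filter)
  from Lim_transform_eventually[OF L this] have "?L 0 = ?R 0"
    by (rule tendsto_unique[OF trivial_limit_at]) (intro tendsto_intros)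
  then show ?thesis by (simp only: True)
qed (rule lagrange_homogeneous_nonzero[OF F k])


text \<open>The Weierstrass product inequality; it converts a small row sum into a lower bound for a
  Blaschke product.\<close>

lemma prod_one_minus_ge:
  fixes f :: "'a \<Rightarrow> real"
  assumes "finite A" "\<And>x. x \<in> A \<Longrightarrow> 0 \<le> f x \<and> f x \<le> 1"
  shows "1 - (\<Sum>x\<in>A. f x) \<le> (\<Prod>x\<in>A. 1 - f x)"
  using assms
proof (induction rule: finite_induct)
  case (insert x A)
  have "(\<Prod>x\<in>A. 1 - f x) \<le> 1" using insert by (intro prod_le_1) auto
  then have "f x * (\<Prod>x\<in>A. 1 - f x) \<le> f x" using insert by (simp add: mult_left_le)
  then show ?case using insert by (simp add: left_diff_distrib)
qed simp

text \<open>After division by the first square: the squared pseudohyperbolic distance and the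
  squared modulus of the normalized Szego Gram entry add up to 1.\<close>

lemma cmod_moebius_identity:
  "(cmod (1 - cnj z * w))\<^sup>2 - (cmod (w - z))\<^sup>2 = (1 - (cmod z)\<^sup>2) * (1 - (cmod w)\<^sup>2)"
  unfolding cmod_power2 by (simp add: power2_eq_square algebra_simps)

lemma one_minus_cnj_mult_nonzero:
  assumes "z \<in> unit_disc" "w \<in> unit_disc"
  shows "1 - cnj z * w \<noteq> 0"
proof
  assume "1 - cnj z * w = 0"
  then have "cmod z * cmod w = 1" by (metis complex_mod_cnj eq_iff_diff_eq_0 norm_mult norm_one)
  moreover have "cmod z * cmod w < 1 * 1"
    using assms by (intro mult_strict_mono') auto
  ultimately show False by simp
qed

text \<open>For the Cauchy matrix C and the diagonal matrix D of the \<open>e j\<close> this says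
  that C D times the transpose of C times the conjugate of D is the identity. Multiplication by
  \<open>P\<close> clears the denominators with index i and leaves a Lagrange sum with value a
  product over l \<noteq> k, which vanishes for i \<noteq> k.\<close>

lemma cauchy_matrix_inverse:
  fixes \<nu> :: "'a \<Rightarrow> complex"
  assumes F: "finite F" "inj_on \<nu> F" and disc: "\<And>i. i \<in> F \<Longrightarrow> \<nu> i \<in> unit_disc"
    and e: "\<And>j. e j = (\<Prod>l\<in>F. 1 - cnj (\<nu> l) * \<nu> j) / (\<Prod>l\<in>F-{j}. \<nu> j - \<nu> l)"
    and i: "i \<in> F" and k: "k \<in> F"
  shows "(\<Sum>j\<in>F. e j / ((1 - cnj (\<nu> i) * \<nu> j) * (1 - cnj (\<nu> k) * \<nu> j))) * cnj (e k) = (if i = k then 1 else 0)"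
proof -
  have nz: "1 - cnj (\<nu> i) * \<nu> j \<noteq> 0" if "i \<in> F" "j \<in> F" for i j
    using disc that by (intro one_minus_cnj_mult_nonzero) auto
  define P where "P = (\<Prod>l\<in>F. 1 - cnj (\<nu> i) * \<nu> l)"
  have P: "P \<noteq> 0" unfolding P_def using F nz i by simp
  let ?\<Sigma> = "\<Sum>j\<in>F. e j / ((1 - cnj (\<nu> i) * \<nu> j) * (1 - cnj (\<nu> k) * \<nu> j))"
  have "P * ?\<Sigma> = (\<Sum>j\<in>F. (\<Prod>l\<in>F-{k}. 1 - cnj (\<nu> l) * \<nu> j) * (\<Prod>l\<in>F-{j}. (1 - cnj (\<nu> i) * \<nu> l) / (\<nu> j - \<nu> l)))"
    unfolding sum_distrib_left
  proof (intro sum.cong refl)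
    fix j assume j: "j \<in> F"
    have "(\<Prod>l\<in>F. 1 - cnj (\<nu> l) * \<nu> j) = (1 - cnj (\<nu> k) * \<nu> j) * (\<Prod>l\<in>F-{k}. 1 - cnj (\<nu> l) * \<nu> j)"
      using F k by (intro prod.remove) auto
    moreover have "P = (1 - cnj (\<nu> i) * \<nu> j) * (\<Prod>l\<in>F-{j}. 1 - cnj (\<nu> i) * \<nu> l)"
      unfolding P_def using F j by (intro prod.remove) auto
    ultimately show "P * (e j / ((1 - cnj (\<nu> i) * \<nu> j) * (1 - cnj (\<nu> k) * \<nu> j))) =
      (\<Prod>l\<in>F-{k}. 1 - cnj (\<nu> l) * \<nu> j) * (\<Prod>l\<in>F-{j}. (1 - cnj (\<nu> i) * \<nu> l) / (\<nu> j - \<nu> l))"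
      using nz[OF i j] nz[OF k j] by (simp add: e prod_dividef)
  qed
  also have "\<dots> = (\<Prod>l\<in>F-{k}. cnj (\<nu> i) - cnj (\<nu> l))"
    by (rule lagrange_homogeneous[OF F k])
  finally have PS: "P * ?\<Sigma> = (\<Prod>l\<in>F-{k}. cnj (\<nu> i) - cnj (\<nu> l))" .
  show ?thesis
  proof (cases "i = k")
    case False
    then have "(\<Prod>l\<in>F-{k}. cnj (\<nu> i) - cnj (\<nu> l)) = 0" using F i by auto
    then show ?thesis using PS P False by simp
  next
    case True
    let ?R = "\<Prod>l\<in>F-{k}. cnj (\<nu> k) - cnj (\<nu> l)"
    have R: "?R \<noteq> 0"
      using F k by (auto simp: inj_on_def)
    have "cnj (e k) = P / ?R"
      unfolding e P_def True by (simp add: mult.commute)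
    then have "?\<Sigma> * cnj (e k) = P * ?\<Sigma> / ?R" by simp
    also have "\<dots> = 1" using PS R True by simp
    finally show ?thesis using True by simp
  qed
qed

text \<open>The modulus of \<open>e k\<close> in the proof is \<open>1 - (cmod (\<nu> k))\<^sup>2\<close> divided by that of the Blaschke product
  of the other points at \<open>\<nu> k\<close>, which the separation hypothesis bounds below.\<close>

lemma szego_gram_lower_bound:
  fixes \<nu> :: "'a \<Rightarrow> complex" and s :: "'a \<Rightarrow> real"
  assumes F: "finite F" and disc: "\<And>i. i \<in> F \<Longrightarrow> \<nu> i \<in> unit_disc"
    and s: "\<And>i. s i > 0" "\<And>i. i \<in> F \<Longrightarrow> (s i)\<^sup>2 = 1 / (1 - (cmod (\<nu> i))\<^sup>2)"
    and g: "\<And>i j. g i j = 1 / ((1 - cnj (\<nu> i) * \<nu> j) * of_real (s i * s j))"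
    and C: "C > 0"
    and lower: "\<And>x. 0 \<le> Re (gram_form g F x)"
    and upper: "\<And>x. Re (gram_form g F x) \<le> C * (\<Sum>i\<in>F. (cmod (x i))\<^sup>2)"
    and sep: "\<And>i. i \<in> F \<Longrightarrow> (\<Sum>j\<in>F-{i}. (cmod (g i j))\<^sup>2) \<le> 1 / 2"
  shows "(\<Sum>i\<in>F. (cmod (a i))\<^sup>2) \<le> 2 * C * Re (gram_form g F a)"
proof -
  define c where "c = (\<lambda>i j. 1 / (1 - cnj (\<nu> i) * \<nu> j))"
  define e where "e = (\<lambda>j. (\<Prod>l\<in>F. 1 - cnj (\<nu> l) * \<nu> j) / (\<Prod>l\<in>F-{j}. \<nu> j - \<nu> l))"
  have gc: "g i j = c i j / of_real (s i * s j)" for i j by (simp add: g c_def)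
  have c_herm: "c j i = cnj (c i j)" for i j by (simp add: c_def mult.commute)
  have g_herm: "g j i = cnj (g i j)" for i j by (simp add: gc c_herm[of i j] mult.commute)
  have pos: "1 - (cmod (\<nu> i))\<^sup>2 > 0" if "i \<in> F" for i
    using disc[OF that] abs_square_less_1[of "cmod (\<nu> i)"] by simp
  have nz: "1 - cnj (\<nu> i) * \<nu> j \<noteq> 0" if "i \<in> F" "j \<in> F" for i j
    using disc that by (intro one_minus_cnj_mult_nonzero) auto
  have cmod_g: "(cmod (g i j))\<^sup>2 = 1 - (cmod (\<nu> j - \<nu> i))\<^sup>2 / (cmod (1 - cnj (\<nu> i) * \<nu> j))\<^sup>2"
    if "i \<in> F" "j \<in> F" for i j
  proof -
    have "(cmod (g i j))\<^sup>2 = 1 / ((cmod (1 - cnj (\<nu> i) * \<nu> j))\<^sup>2 * ((s i)\<^sup>2 * (s j)\<^sup>2))"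
      using s(1)[of i] s(1)[of j]
      unfolding g norm_divide norm_mult norm_of_real by (simp add: power_mult_distrib power_divide)
    also have "\<dots> = (1 - (cmod (\<nu> i))\<^sup>2) * (1 - (cmod (\<nu> j))\<^sup>2) / (cmod (1 - cnj (\<nu> i) * \<nu> j))\<^sup>2"
      using that by (simp add: s(2))
    also have "\<dots> = 1 - (cmod (\<nu> j - \<nu> i))\<^sup>2 / (cmod (1 - cnj (\<nu> i) * \<nu> j))\<^sup>2"
      unfolding cmod_moebius_identity[symmetric] using nz[OF that] by (simp add: field_simps)
    finally show ?thesis .
  qed
  have inj: "inj_on \<nu> F"
  proof (rule inj_onI, rule ccontr)
    fix i j assume ij: "i \<in> F" "j \<in> F" "\<nu> i = \<nu> j" "i \<noteq> j"
    have "(cmod (g i j))\<^sup>2 = 1" using cmod_g[OF ij(1,2)] ij(3) by simp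
    moreover have "(cmod (g i j))\<^sup>2 \<le> (\<Sum>j\<in>F-{i}. (cmod (g i j))\<^sup>2)"
      using F ij by (intro member_le_sum) auto
    ultimately show False using sep[OF ij(1)] by simp
  qed
  \<comment> \<open>Duality by the inverse formula: \<open>u\<close> has the same energy as
    \<open>b\<close>, while \<open>b\<close> is, up to conjugation, a diagonal multiple of
    \<open>z\<close>, the Cauchy matrix applied to \<open>u\<close>. An upper bound for
    \<open>z\<close> by the energy of \<open>u\<close> is thus a lower bound for the energy of
    \<open>b\<close>.\<close>
  define b where "b = (\<lambda>i. a i / of_real (s i))"
  define y where "y = (\<lambda>j. \<Sum>i\<in>F. b i * c i j)"
  define u where "u = (\<lambda>j. cnj (y j * e j))"
  define z where "z = (\<lambda>k. \<Sum>j\<in>F. u j * c j k)"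
  have bz: "b k = cnj (z k * e k)" if k: "k \<in> F" for k
  proof -
    have "cnj (z k * e k) = (\<Sum>j\<in>F. y j * e j * c k j) * cnj (e k)"
      by (simp add: z_def u_def c_herm[symmetric])
    also have "\<dots> = (\<Sum>j\<in>F. \<Sum>i\<in>F. b i * (e j / ((1 - cnj (\<nu> i) * \<nu> j) * (1 - cnj (\<nu> k) * \<nu> j)) * cnj (e k)))"
      unfolding sum_distrib_right
    proof (intro sum.cong refl)
      fix j
      have "y j * e j * c k j * cnj (e k) = (\<Sum>i\<in>F. b i * c i j) * (e j * c k j * cnj (e k))"
        by (simp only: y_def mult.assoc)
      then show "y j * e j * c k j * cnj (e k) =
          (\<Sum>i\<in>F. b i * (e j / ((1 - cnj (\<nu> i) * \<nu> j) * (1 - cnj (\<nu> k) * \<nu> j)) * cnj (e k)))"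
        by (simp only: sum_distrib_right) (simp add: c_def mult_ac)
    qed
    also have "\<dots> = (\<Sum>i\<in>F. b i * ((\<Sum>j\<in>F. e j / ((1 - cnj (\<nu> i) * \<nu> j) * (1 - cnj (\<nu> k) * \<nu> j))) * cnj (e k)))"
      by (subst sum.swap) (simp only: sum_distrib_right sum_distrib_left)
    also have "\<dots> = (\<Sum>i\<in>F. b i * (if i = k then 1 else 0))"
      using cauchy_matrix_inverse[OF F inj disc e_def[THEN fun_cong] _ k] by (intro sum.cong) auto
    also have "\<dots> = b k" using F k by (simp add: if_distrib cong: if_cong)
    finally show ?thesis by simp
  qed
  have "gram_form c F b = (\<Sum>j\<in>F. cnj (b j) * y j)"
    unfolding gram_form_def y_def by (subst sum.swap) (simp add: sum_distrib_left mult_ac)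
  also have "\<dots> = (\<Sum>j\<in>F. z j * cnj (u j))"
    by (intro sum.cong refl) (simp add: bz u_def)
  also have "\<dots> = gram_form c F u"
    unfolding gram_form_def z_def by (subst sum.swap) (simp add: sum_distrib_right sum_distrib_left mult_ac)
  finally have bu: "gram_form c F b = gram_form c F u" .
  have s_nz: "complex_of_real (s i) \<noteq> 0" for i using s(1)[of i] by simp
  have "gram_form g F a = gram_form c F b"
    unfolding gram_form_def b_def gc by (intro sum.cong refl) simp
  moreover have "gram_form g F (\<lambda>j. of_real (s j) * u j) = gram_form c F u"
    unfolding gram_form_def gc using s_nz by (intro sum.cong refl) (simp add: field_simps)
  ultimately have au: "gram_form g F a = gram_form g F (\<lambda>j. of_real (s j) * u j)"
    using bu by simp
  \<comment> \<open>The 2 is the reciprocal of the lower bound 1 / 2 for the squared modulus of the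
    Blaschke product omitting k.\<close>
  have "(\<Sum>i\<in>F. (cmod (a i))\<^sup>2) \<le> (\<Sum>k\<in>F. 2 * (cmod (\<Sum>j\<in>F. of_real (s j) * u j * g j k))\<^sup>2)"
  proof (rule sum_mono)
    fix k assume k: "k \<in> F"
    have "(\<Sum>j\<in>F. of_real (s j) * u j * g j k) = z k / of_real (s k)"
      unfolding z_def gc sum_divide_distrib using s_nz by (intro sum.cong refl) (simp add: field_simps)
    then have gz: "(cmod (\<Sum>j\<in>F. of_real (s j) * u j * g j k))\<^sup>2 = (cmod (z k))\<^sup>2 / (s k)\<^sup>2"
      by (simp add: norm_divide power_divide)
    have "a k = b k * of_real (s k)" using s_nz by (simp add: b_def)
    then have az: "(cmod (a k))\<^sup>2 = (cmod (z k))\<^sup>2 * ((cmod (e k))\<^sup>2 * (s k)\<^sup>2)"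
      using bz[OF k] by (simp add: norm_mult power_mult_distrib)
    define \<rho> where "\<rho> = (\<lambda>l. (cmod (\<nu> l - \<nu> k))\<^sup>2 / (cmod (1 - cnj (\<nu> k) * \<nu> l))\<^sup>2)"
    have "cmod (1 - cnj (\<nu> k) * \<nu> k) = 1 - (cmod (\<nu> k))\<^sup>2"
    proof -
      have "1 - cnj (\<nu> k) * \<nu> k = of_real (1 - (cmod (\<nu> k))\<^sup>2)"
        unfolding of_real_diff complex_norm_square by (simp add: mult.commute)
      then show ?thesis using pos[OF k] by (simp only: norm_of_real abs_of_pos)
    qed
    moreover have "(cmod (e k))\<^sup>2 = (cmod (1 - cnj (\<nu> k) * \<nu> k))\<^sup>2 * (1 / (\<Prod>l\<in>F-{k}. \<rho> l))"
    proof -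
      have sym: "cmod (1 - cnj (\<nu> l) * \<nu> k) = cmod (1 - cnj (\<nu> k) * \<nu> l)" for l
        by (metis complex_cnj_cnj complex_cnj_diff complex_cnj_mult complex_cnj_one complex_mod_cnj mult.commute)
      have "e k = (1 - cnj (\<nu> k) * \<nu> k) * (\<Prod>l\<in>F-{k}. 1 - cnj (\<nu> l) * \<nu> k) / (\<Prod>l\<in>F-{k}. \<nu> k - \<nu> l)"
        unfolding e_def using F k by (simp add: prod.remove)
      moreover have np: "(cmod (\<Prod>l\<in>A. f l))\<^sup>2 = (\<Prod>l\<in>A. (cmod (f l))\<^sup>2)" for A :: "'a set" and f
        by (simp only: prod_norm[symmetric] prod_power_distrib)
      ultimately have "(cmod (e k))\<^sup>2 = (cmod (1 - cnj (\<nu> k) * \<nu> k))\<^sup>2 *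
         ((\<Prod>l\<in>F-{k}. (cmod (1 - cnj (\<nu> l) * \<nu> k))\<^sup>2) / (\<Prod>l\<in>F-{k}. (cmod (\<nu> k - \<nu> l))\<^sup>2))"
        by (simp only: norm_mult norm_divide power_mult_distrib power_divide times_divide_eq_right)
      also have "(\<Prod>l\<in>F-{k}. (cmod (1 - cnj (\<nu> l) * \<nu> k))\<^sup>2) = (\<Prod>l\<in>F-{k}. (cmod (1 - cnj (\<nu> k) * \<nu> l))\<^sup>2)"
        by (intro prod.cong refl arg_cong[of _ _ "\<lambda>x. x\<^sup>2"] sym)
      also have "(\<Prod>l\<in>F-{k}. (cmod (\<nu> k - \<nu> l))\<^sup>2) = (\<Prod>l\<in>F-{k}. (cmod (\<nu> l - \<nu> k))\<^sup>2)"
        by (intro prod.cong refl arg_cong[of _ _ "\<lambda>x. x\<^sup>2"] norm_minus_commute)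
      finally show ?thesis by (simp add: \<rho>_def prod_dividef)
    qed
    ultimately have "(cmod (e k))\<^sup>2 * (s k)\<^sup>2 * (s k)\<^sup>2 =
        ((1 - (cmod (\<nu> k))\<^sup>2) * (s k)\<^sup>2)\<^sup>2 * (1 / (\<Prod>l\<in>F-{k}. \<rho> l))"
      by (simp add: power2_eq_square)
    also have "(1 - (cmod (\<nu> k))\<^sup>2) * (s k)\<^sup>2 = 1"
      using pos[OF k] by (simp add: s(2)[OF k])
    finally have "(cmod (e k))\<^sup>2 * (s k)\<^sup>2 * (s k)\<^sup>2 = 1 / (\<Prod>l\<in>F-{k}. \<rho> l)"
      by simp
    moreover have "1 / 2 \<le> (\<Prod>l\<in>F-{k}. \<rho> l)"
    proof -
      have rho: "\<rho> l = 1 - (cmod (g k l))\<^sup>2" if "l \<in> F" for l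
        using cmod_g[OF k that] by (simp add: \<rho>_def)
      have "\<rho> l \<ge> 0" for l by (simp add: \<rho>_def)
      then have "(cmod (g k l))\<^sup>2 \<le> 1" if "l \<in> F" for l
        using rho[OF that] by (metis diff_ge_0_iff_ge)
      then have "1 - (\<Sum>l\<in>F-{k}. (cmod (g k l))\<^sup>2) \<le> (\<Prod>l\<in>F-{k}. 1 - (cmod (g k l))\<^sup>2)"
        using F by (intro prod_one_minus_ge) auto
      also have "\<dots> = (\<Prod>l\<in>F-{k}. \<rho> l)" using rho by (intro prod.cong) auto
      finally show ?thesis using sep[OF k] by linarith
    qed
    ultimately have "(cmod (e k))\<^sup>2 * (s k)\<^sup>2 * (s k)\<^sup>2 \<le> 2"
      by (simp add: divide_le_eq)
    then have "(cmod (e k))\<^sup>2 * (s k)\<^sup>2 \<le> 2 / (s k)\<^sup>2"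
      using s(1)[of k] by (simp add: pos_le_divide_eq)
    then have "(cmod (z k))\<^sup>2 * ((cmod (e k))\<^sup>2 * (s k)\<^sup>2) \<le> (cmod (z k))\<^sup>2 * (2 / (s k)\<^sup>2)"
      by (intro mult_left_mono) auto
    then show "(cmod (a k))\<^sup>2 \<le> 2 * (cmod (\<Sum>j\<in>F. of_real (s j) * u j * g j k))\<^sup>2"
      unfolding gz az by (simp add: mult.commute)
  qed
  also have "\<dots> \<le> 2 * (C * Re (gram_form g F (\<lambda>j. of_real (s j) * u j)))"
    unfolding sum_distrib_left[symmetric]
    by (intro mult_left_mono gram_form_bound_imp_norm_bound g_herm C lower upper) auto
  finally show ?thesis by (simp add: au)
qed

section \<open>The kernel takes values near a sector\<close>

text \<open>From (\<gamma> + n) / (\<gamma> n) = 1 / \<gamma> + 1 / n. The first part consists of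
  the binomial coefficients of (1 - x)^(-\<gamma>); for \<gamma> < 1 the second is summable and
  contributes a bounded function.\<close>

lemma kernel_coeff_eq_pochhammer:
  assumes "0 < \<gamma>"
  shows "kernel_coeff (1 - \<gamma>) n = pochhammer \<gamma> n / fact n / (pi * \<gamma>) +
    (if n = 0 then 1 - 1 / (pi * \<gamma>) else pochhammer \<gamma> n / fact n / (pi * real n))"
proof (cases "n = 0")
  case False
  have "pochhammer (1 + \<gamma>) n * \<gamma> = pochhammer \<gamma> n * (\<gamma> + real n)"
    using pochhammer_rec[of \<gamma> n] pochhammer_Suc[of \<gamma> n] by (simp add: add.commute mult.commute)
  then have p: "pochhammer (1 + \<gamma>) n = pochhammer \<gamma> n * (\<gamma> + real n) / \<gamma>"
    using assms by (simp add: field_simps)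
  show ?thesis using False assms by (simp add: kernel_coeff_def p field_simps)
qed (simp add: kernel_coeff_def)

text \<open>The decrements of \<open>u\<close> equal (1 - \<gamma>) u n / (n + 1), so the series
  telescopes against a decreasing nonnegative sequence.\<close>

lemma summable_pochhammer_fact_div:
  fixes \<gamma> :: real
  assumes "0 < \<gamma>" "\<gamma> < 1"
  shows "summable (\<lambda>n. pochhammer \<gamma> n / fact n / real n)"
proof -
  define u where "u = (\<lambda>n. pochhammer \<gamma> n / fact n)"
  have u: "u n \<ge> 0" for n using assms by (auto simp: u_def intro!: divide_nonneg_nonneg pochhammer_nonneg)
  have uS: "u (Suc n) = u n * (\<gamma> + real n) / (real n + 1)" for n
    by (simp add: u_def pochhammer_Suc)
  then have step: "u n - u (Suc n) = (1 - \<gamma>) * (u n / (real n + 1))" for n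
    by (simp add: field_simps)
  have "decseq u"
  proof (rule decseq_SucI)
    fix n
    have "u n - u (Suc n) \<ge> 0"
      unfolding step using u assms by (intro mult_nonneg_nonneg divide_nonneg_nonneg) auto
    then show "u (Suc n) \<le> u n" by simp
  qed
  then obtain l where "u \<longlonglongrightarrow> l"
    using decseq_convergent[of u 0] u by blast
  from telescope_summable'[OF this] have "summable (\<lambda>n. (1 - \<gamma>) * (u n / (real n + 1)))"
    by (simp only: step)
  then have "summable (\<lambda>n. u n / (real n + 1))"
    using assms summable_cmult_iff[of "1 - \<gamma>" "\<lambda>n. u n / (real n + 1)"] by simp
  then have "summable (\<lambda>n. 2 * (u n / (real n + 1)))" by (rule summable_mult)
  then have "summable (\<lambda>n. u n / real n)"
  proof (rule summable_comparison_test'[where N = 0])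
    fix n show "norm (u n / real n) \<le> 2 * (u n / (real n + 1))"
    proof (cases "n = 0")
      case False
      then have "u n / real n \<le> u n * (2 / (real n + 1))"
        using mult_left_mono[OF _ u, of "1 / real n" "2 / (real n + 1)" n] by (simp add: field_simps)
      then show ?thesis using u[of n] by (simp add: mult.commute)
    qed (use u in simp)
  qed
  then show ?thesis by (simp add: u_def)
qed

lemma powr_minus_sums:
  fixes \<gamma> :: real
  assumes "cmod x < 1"
  shows "(\<lambda>n. of_real (pochhammer \<gamma> n / fact n) * x ^ n) sums (1 - x) powr (- of_real \<gamma>)"
proof -
  have "(\<lambda>n. (- complex_of_real \<gamma> gchoose n) * (- x) ^ n) sums (1 + - x) powr (- of_real \<gamma>)"
    by (rule gen_binomial_complex) (use assms in simp)
  moreover have "(- complex_of_real \<gamma> gchoose n) * (- x) ^ n = of_real (pochhammer \<gamma> n / fact n) * x ^ n" for n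
  proof -
    have "(- 1 :: complex) ^ n * (- x) ^ n = x ^ n"
      unfolding power_mult_distrib[symmetric] by simp
    then show ?thesis
      by (simp add: gbinomial_pochhammer pochhammer_of_real mult.commute mult.left_commute)
  qed
  ultimately show ?thesis by simp
qed

text \<open>The power maps the right half-plane into the sector of half-angle \<gamma> pi / 2, where
  the cosine of that angle compares real part and modulus.\<close>

lemma Re_powr_minus_ge:
  fixes \<gamma> :: real
  assumes "0 < \<gamma>" "\<gamma> < 1" "Re z > 0"
  shows "cos (\<gamma> * pi / 2) * cmod (z powr (- of_real \<gamma>)) \<le> Re (z powr (- of_real \<gamma>))"
proof -
  have z: "z \<noteq> 0" using assms by auto
  define t where "t = Im (Ln z)"
  have t: "\<bar>t\<bar> < pi / 2" unfolding t_def using assms by (intro Re_Ln_pos_lt_imp)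
  have e: "z powr (- of_real \<gamma>) = exp (- of_real \<gamma> * Ln z)" using z by (simp add: powr_def)
  have n: "cmod (z powr (- of_real \<gamma>)) = exp (- \<gamma> * Re (Ln z))" unfolding e by simp
  have "Re (z powr (- of_real \<gamma>)) = exp (- \<gamma> * Re (Ln z)) * cos (\<gamma> * t)"
    unfolding e Re_exp by (simp add: t_def)
  moreover have "cos (\<gamma> * pi / 2) \<le> cos (\<gamma> * t)"
  proof -
    have "cos (\<gamma> * pi / 2) \<le> cos \<bar>\<gamma> * t\<bar>"
    proof (rule cos_monotone_0_pi_le)
      show "\<bar>\<gamma> * t\<bar> \<le> \<gamma> * pi / 2"
        using mult_left_mono[of "\<bar>t\<bar>" "pi / 2" \<gamma>] t assms by (simp add: abs_mult)
      show "\<gamma> * pi / 2 \<le> pi" using assms mult_right_mono[of \<gamma> 1 pi] by simp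
    qed simp
    then show ?thesis by simp
  qed
  ultimately show ?thesis unfolding n by (simp add: mult.commute)
qed

text \<open>For \<alpha> = 1 the kernel is 1 - Ln (1 - x) / pi, whose imaginary part is bounded; for
  \<alpha> < 1 it is a power with values in a sector plus a bounded function. The inner K
  accommodates the bounded part.\<close>

lemma kernel_series_sector_bound:
  assumes "0 < \<alpha>" "\<alpha> \<le> 1"
  obtains K where "K > 0" "\<And>x. cmod x < 1 \<Longrightarrow> cmod (kernel_series \<alpha> x) \<le> K * (Re (kernel_series \<alpha> x) + K)"
proof (cases "\<alpha> = 1")
  case True
  have coeff: "kernel_coeff 1 n = (if n = 0 then 1 else 1 / (pi * real n))" for n
    by (simp add: kernel_coeff_def pochhammer_fact[symmetric])
  show ?thesis
  proof (rule that[of 2])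
    fix x :: complex assume x: "cmod x < 1"
    have "(\<lambda>n. - ((- (- x)) ^ n) / of_nat n) sums Ln (1 + - x)"
      by (rule Ln_series') (use x in simp)
    then have "(\<lambda>n. - 1 / of_real pi * (- (x ^ n) / of_nat n)) sums (- 1 / of_real pi * Ln (1 - x))"
      by (intro sums_mult) simp
    then have "(\<lambda>n. (if n = 0 then 1 else 0) + - 1 / of_real pi * (- (x ^ n) / of_nat n)) sums
        (1 + - 1 / of_real pi * Ln (1 - x))"
      using sums_single[of 0 "\<lambda>_. 1::complex"] by (intro sums_add) simp_all
    moreover have "(if n = 0 then 1 else 0) + - 1 / of_real pi * (- (x ^ n) / of_nat n) =
        of_real (kernel_coeff 1 n) * x ^ n" for n
      by (simp add: coeff)
    ultimately have "(\<lambda>n. of_real (kernel_coeff 1 n) * x ^ n) sums (1 + - 1 / of_real pi * Ln (1 - x))"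
      by simp
    then have eq: "kernel_series \<alpha> x = 1 - Ln (1 - x) / of_real pi"
      unfolding kernel_series_def True by (simp add: sums_unique[symmetric])
    have Re1: "Re (1 - x) > 0" using x complex_Re_le_cmod[of x] by simp
    then have nz: "1 - x \<noteq> 0" by auto
    have "Re (Ln (1 - x)) = ln (cmod (1 - x))" using nz by simp
    also have "\<dots> \<le> cmod (1 - x) - 1" using nz by (intro ln_le_minus_one) simp
    also have "\<dots> \<le> 1" using norm_triangle_ineq4[of 1 x] x by simp
    finally have "Re (Ln (1 - x)) / pi \<le> 1" using pi_ge_two by (simp add: divide_le_eq)
    then have Re0: "Re (kernel_series \<alpha> x) \<ge> 0"
      unfolding eq by (simp add: Re_divide_of_real)
    have "\<bar>Im (Ln (1 - x))\<bar> \<le> pi" using Re_Ln_pos_lt_imp[OF Re1] pi_ge_two by linarith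
    then have Im1: "\<bar>Im (kernel_series \<alpha> x)\<bar> \<le> 1"
      unfolding eq by (simp add: Im_divide_of_real divide_le_eq)
    have "cmod (kernel_series \<alpha> x) \<le> \<bar>Re (kernel_series \<alpha> x)\<bar> + \<bar>Im (kernel_series \<alpha> x)\<bar>"
      by (rule cmod_le)
    then show "cmod (kernel_series \<alpha> x) \<le> 2 * (Re (kernel_series \<alpha> x) + 2)"
      using Re0 Im1 by simp
  qed simp
next
  case False
  define \<gamma> where "\<gamma> = 1 - \<alpha>"
  have \<gamma>: "0 < \<gamma>" "\<gamma> < 1" "\<alpha> = 1 - \<gamma>" using assms False by (auto simp: \<gamma>_def)
  define d where "d = (\<lambda>n. if n = 0 then 1 - 1 / (pi * \<gamma>) else pochhammer \<gamma> n / fact n / (pi * real n))"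
  have sd: "summable (\<lambda>n. \<bar>d n\<bar>)"
  proof (rule summable_comparison_test'[where N = 1])
    show "summable (\<lambda>n. 1 / pi * (pochhammer \<gamma> n / fact n / real n))"
      using \<gamma> by (intro summable_mult summable_pochhammer_fact_div)
    fix n :: nat assume "1 \<le> n"
    moreover have "pochhammer \<gamma> n \<ge> 0" using \<gamma> by (intro pochhammer_nonneg) auto
    ultimately show "norm \<bar>d n\<bar> \<le> 1 / pi * (pochhammer \<gamma> n / fact n / real n)"
      by (simp add: d_def mult_ac)
  qed
  define D where "D = (\<Sum>n. \<bar>d n\<bar>)"
  define \<kappa> where "\<kappa> = cos (\<gamma> * pi / 2)"
  have \<kappa>: "0 < \<kappa>" "\<kappa> \<le> 1"
  proof -
    have "- (pi / 2) < \<gamma> * pi / 2" "\<gamma> * pi / 2 < pi / 2"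
      using mult_strict_right_mono[OF \<gamma>(2), of pi] mult_pos_pos[OF \<gamma>(1) pi_gt_zero] pi_gt_zero
      by linarith+
    then show "0 < \<kappa>" "\<kappa> \<le> 1"
      unfolding \<kappa>_def by (auto intro: cos_gt_zero_pi)
  qed
  have D: "D \<ge> 0" unfolding D_def by (intro suminf_nonneg sd) auto
  have key: "cmod (kernel_series \<alpha> x) \<le> 1 / \<kappa> * (Re (kernel_series \<alpha> x) + 2 * D)" if x: "cmod x < 1" for x
  proof -
    define h where "h = (1 - x) powr (- of_real \<gamma>)"
    define \<psi> where "\<psi> = (\<Sum>n. of_real (d n) * x ^ n)"
    have le: "cmod (of_real (d n) * x ^ n) \<le> \<bar>d n\<bar>" for n
      using mult_left_mono[of "cmod x ^ n" 1 "\<bar>d n\<bar>"] x by (simp add: norm_mult norm_power power_le_one)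
    have \<psi>: "(\<lambda>n. of_real (d n) * x ^ n) sums \<psi>"
      unfolding \<psi>_def by (rule summable_sums, rule summable_comparison_test'[OF sd, of 0]) (rule le)
    have \<psi>D: "cmod \<psi> \<le> D"
      unfolding \<psi>_def D_def by (rule norm_suminf_le[OF le sd])
    have "(\<lambda>n. 1 / (pi * \<gamma>) * (of_real (pochhammer \<gamma> n / fact n) * x ^ n) + of_real (d n) * x ^ n) sums
        (of_real (1 / (pi * \<gamma>)) * h + \<psi>)"
      unfolding h_def of_real_divide by (intro sums_add sums_mult \<psi>) (use powr_minus_sums[OF x, of \<gamma>] in simp)
    moreover have "1 / (pi * \<gamma>) * (of_real (pochhammer \<gamma> n / fact n) * x ^ n) + of_real (d n) * x ^ n =
        of_real (kernel_coeff \<alpha> n) * x ^ n" for n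
      unfolding \<gamma>(3) kernel_coeff_eq_pochhammer[OF \<gamma>(1)] d_def[symmetric]
      by (simp add: d_def distrib_right)
    ultimately have "(\<lambda>n. of_real (kernel_coeff \<alpha> n) * x ^ n) sums (of_real (1 / (pi * \<gamma>)) * h + \<psi>)"
      by simp
    then have eq: "kernel_series \<alpha> x = of_real (1 / (pi * \<gamma>)) * h + \<psi>"
      unfolding kernel_series_def by (simp add: sums_unique[symmetric])
    have pg: "1 / (pi * \<gamma>) > 0" using \<gamma> by simp
    have h: "\<kappa> * cmod h \<le> Re h"
      unfolding \<kappa>_def h_def
      by (rule Re_powr_minus_ge) (use \<gamma> x complex_Re_le_cmod[of x] in auto)
    have "\<kappa> * cmod (kernel_series \<alpha> x) \<le> \<kappa> * (1 / (pi * \<gamma>) * cmod h + D)"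
      unfolding eq using \<kappa> pg \<psi>D norm_triangle_ineq[of "of_real (1 / (pi * \<gamma>)) * h" \<psi>]
      by (intro mult_left_mono) (auto simp: norm_mult simp del: of_real_divide of_real_mult)
    also have "\<dots> \<le> 1 / (pi * \<gamma>) * (\<kappa> * cmod h) + D"
      using \<kappa> D by (simp add: algebra_simps mult_left_le)
    also have "\<dots> \<le> 1 / (pi * \<gamma>) * Re h + D"
      using h pg by (intro add_right_mono mult_left_mono) auto
    also have "\<dots> = Re (kernel_series \<alpha> x) - Re \<psi> + D"
      unfolding eq by simp
    also have "\<dots> \<le> Re (kernel_series \<alpha> x) + 2 * D"
      using abs_Re_le_cmod[of \<psi>] \<psi>D by linarith
    finally show ?thesis using \<kappa> by (simp add: field_simps)
  qed
  define K where "K = max (1 / \<kappa>) (2 * D)"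
  have K: "K \<ge> 1 / \<kappa>" "K \<ge> 2 * D" "K > 0" using \<kappa> by (auto simp: K_def less_max_iff_disj)
  show ?thesis
  proof (rule that[OF K(3)])
    fix x :: complex assume x: "cmod x < 1"
    \<comment> \<open>Nonnegativity of the second factor is what permits enlarging both constants to
      K at once.\<close>
    have "0 \<le> 1 / \<kappa> * (Re (kernel_series \<alpha> x) + 2 * D)"
      using key[OF x] norm_ge_zero order_trans by blast
    then have "0 \<le> Re (kernel_series \<alpha> x) + 2 * D"
      using \<kappa> by (simp add: zero_le_mult_iff zero_le_divide_iff)
    then have "1 / \<kappa> * (Re (kernel_series \<alpha> x) + 2 * D) \<le> K * (Re (kernel_series \<alpha> x) + K)"
      using K by (intro mult_mono) auto
    with key[OF x] show "cmod (kernel_series \<alpha> x) \<le> K * (Re (kernel_series \<alpha> x) + K)" by linarith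
  qed
qed

section \<open>Partition into Riesz sequences\<close>

lemma bessel_sequenceE:
  assumes "bessel_sequence N I x"
  obtains B where "B > 0" "\<And>F a. finite F \<Longrightarrow> F \<subseteq> I \<Longrightarrow>
    (N (\<lambda>z. \<Sum>n\<in>F. a n * x n z))\<^sup>2 \<le> B * (\<Sum>n\<in>F. (cmod (a n))\<^sup>2)"
proof -
  from assms obtain B where "B > 0" and B: "\<forall>F a. finite F \<and> F \<subseteq> I \<longrightarrow>
      (N (\<lambda>z. \<Sum>n\<in>F. a n * x n z))\<^sup>2 \<le> B * (\<Sum>n\<in>F. (cmod (a n))\<^sup>2)"
    unfolding bessel_sequence_def by (elim exE conjE) (rule that)
  show ?thesis
    by (rule that[OF \<open>B > 0\<close>]) (rule B[rule_format], rule conjI)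
qed

text \<open>The Bessel bound passes to every class, so only the lower bound depends on the
  colouring.\<close>

lemma riesz_partition_from_finite_colorings:
  assumes bessel: "bessel_sequence N {1..} x" and A: "A > 0"
    and col: "\<And>n. \<exists>c::nat \<Rightarrow> nat. (\<forall>i. c i < r) \<and> (\<forall>F\<subseteq>{1..n}. monochromatic c F \<longrightarrow>
       (\<forall>a. A * (\<Sum>n\<in>F. (cmod (a n))\<^sup>2) \<le> (N (\<lambda>z. \<Sum>n\<in>F. a n * x n z))\<^sup>2))"
  shows "\<exists>(r::nat) (J :: nat \<Rightarrow> nat set).
           (\<Union>j\<in>{1..r}. J j) = {1..} \<and> disjoint_family_on J {1..r} \<and>
           (\<forall>j\<in>{1..r}. riesz_sequence N (J j) x)"
proof -
  obtain c where c: "\<And>i. c i < r"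
    and lower: "\<And>F. finite F \<Longrightarrow> F \<subseteq> {1..} \<Longrightarrow> monochromatic c F \<Longrightarrow>
       (\<forall>a. A * (\<Sum>n\<in>F. (cmod (a n))\<^sup>2) \<le> (N (\<lambda>z. \<Sum>n\<in>F. a n * x n z))\<^sup>2)"
    by (rule coloring_compactness[of r "\<lambda>F. \<forall>a. A * (\<Sum>n\<in>F. (cmod (a n))\<^sup>2) \<le> (N (\<lambda>z. \<Sum>n\<in>F. a n * x n z))\<^sup>2"])
       (rule col, rule that)
  obtain B where B: "B > 0" and upper: "\<And>F a. finite F \<Longrightarrow> F \<subseteq> {1..} \<Longrightarrow>
      (N (\<lambda>z. \<Sum>n\<in>F. a n * x n z))\<^sup>2 \<le> B * (\<Sum>n\<in>F. (cmod (a n))\<^sup>2)"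
    by (rule bessel_sequenceE[OF bessel], rule that)
  \<comment> \<open>Colours start at 0, labels of classes at 1.\<close>
  define J where "J = (\<lambda>j. {n. n \<ge> 1 \<and> Suc (c n) = j})"
  have "(\<Union>j\<in>{1..r}. J j) = {1..}"
    using c by (force simp: J_def Suc_le_eq)
  moreover have "disjoint_family_on J {1..r}"
    by (auto simp: disjoint_family_on_def J_def)
  moreover have "riesz_sequence N (J j) x" for j
    unfolding riesz_sequence_def
  proof (intro exI conjI allI impI)
    fix F :: "nat set" and a assume "finite F \<and> F \<subseteq> J j"
    then have F: "finite F" "F \<subseteq> {1..}" "monochromatic c F"
      by (auto simp: J_def monochromatic_def)
    show "A * (\<Sum>n\<in>F. (cmod (a n))\<^sup>2) \<le> (N (\<lambda>z. \<Sum>n\<in>F. a n * x n z))\<^sup>2"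
      using lower[OF F] by blast
    show "(N (\<lambda>z. \<Sum>n\<in>F. a n * x n z))\<^sup>2 \<le> B * (\<Sum>n\<in>F. (cmod (a n))\<^sup>2)"
      by (rule upper[OF F(1,2)])
  qed fact+
  ultimately show ?thesis by blast
qed

section \<open>The Gram matrix of the kernels, and orders \<alpha> > 0\<close>

context
  fixes \<alpha> :: real and \<mu> :: "nat \<Rightarrow> complex"
  assumes \<alpha>: "0 \<le> \<alpha>" "\<alpha> \<le> 1"
    and disc: "\<And>n. n \<ge> 1 \<Longrightarrow> \<mu> n \<in> unit_disc"
begin

text \<open>Left unnormalized, so that its form is a power series sum; the normalization is moved
  into the coefficients.\<close>

definition kernel_gram :: "nat \<Rightarrow> nat \<Rightarrow> complex" where
  "kernel_gram i j = kernel_series \<alpha> (cnj (\<mu> i) * \<mu> j)"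

definition kernel_norm :: "nat \<Rightarrow> real" where
  "kernel_norm n = dirichlet_norm \<alpha> (dirichlet_kernel \<alpha> (\<mu> n))"

lemma kernel_gram_form_sums:
  assumes "finite F" "F \<subseteq> {1..}"
  shows "(\<lambda>n. kernel_coeff \<alpha> n * (cmod (\<Sum>i\<in>F. x i * cnj (\<mu> i) ^ n))\<^sup>2) sums
      Re (gram_form kernel_gram F x)"
  unfolding kernel_gram_def
  by (intro gram_form_sums assms kernel_series_sums \<alpha> cmod_mult_disc disc) (use assms in auto)

text \<open>The term n = 0 of a series of nonnegative terms. It absorbs the additive constant of the
  sector bound.\<close>

lemma kernel_gram_form_ge_constant_term:
  assumes "finite F" "F \<subseteq> {1..}"
  shows "(cmod (\<Sum>i\<in>F. x i))\<^sup>2 \<le> Re (gram_form kernel_gram F x)"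
proof -
  let ?f = "\<lambda>n. kernel_coeff \<alpha> n * (cmod (\<Sum>i\<in>F. x i * cnj (\<mu> i) ^ n))\<^sup>2"
  have "sum ?f {0} \<le> suminf ?f"
    using kernel_gram_form_sums[OF assms, of x] kernel_coeff_pos[OF \<alpha>(2)]
    by (intro sum_le_suminf) (auto simp: sums_iff less_imp_le)
  then show ?thesis using kernel_gram_form_sums[OF assms, of x] by (simp add: sums_iff)
qed

lemma kernel_norm_power2:
  assumes "n \<ge> 1"
  shows "complex_of_real ((kernel_norm n)\<^sup>2) = kernel_gram n n"
  using dirichlet_norm_kernel_combination[OF \<alpha>, of "{n}" \<mu> "\<lambda>_. 1"] disc[OF assms]
  by (simp add: kernel_norm_def kernel_gram_def dirichlet_kernel_eq[OF \<alpha>])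

lemma kernel_norm_pos:
  assumes "n \<ge> 1"
  shows "kernel_norm n > 0"
proof -
  have "1 \<le> (kernel_norm n)\<^sup>2"
    using kernel_gram_form_ge_constant_term[of "{n}" "\<lambda>_. 1"] assms arg_cong[OF kernel_norm_power2[OF assms], of Re]
    by (simp add: gram_form_def)
  moreover have "kernel_norm n \<ge> 0"
    unfolding kernel_norm_def dirichlet_norm_def set_lebesgue_integral_def
    by (intro real_sqrt_ge_zero add_nonneg_nonneg integral_nonneg_AE) auto
  ultimately show ?thesis by (cases "kernel_norm n = 0") auto
qed

lemma normalized_kernel_combination_norm:
  assumes "finite F" "F \<subseteq> {1..}"
  shows "(dirichlet_norm \<alpha> (\<lambda>z. \<Sum>n\<in>F. a n * normalized_dirichlet_kernel \<alpha> (\<mu> n) z))\<^sup>2 =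
     Re (gram_form kernel_gram F (\<lambda>n. a n / of_real (kernel_norm n)))"
proof -
  have "(\<lambda>z. \<Sum>n\<in>F. a n * normalized_dirichlet_kernel \<alpha> (\<mu> n) z) =
     (\<lambda>z. \<Sum>n\<in>F. a n / of_real (kernel_norm n) * kernel_fun \<alpha> (\<mu> n) z)"
    using assms disc
    by (intro ext sum.cong refl)
       (auto simp: normalized_dirichlet_kernel_def kernel_norm_def dirichlet_kernel_eq[OF \<alpha>])
  then show ?thesis
    using arg_cong[OF dirichlet_norm_kernel_combination[OF \<alpha>, of F \<mu> "\<lambda>n. a n / of_real (kernel_norm n)"], of Re]
      assms disc by (auto simp: gram_form_def kernel_gram_def)
qed

lemma kernel_gram_commute:
  assumes "i \<ge> 1" "j \<ge> 1"
  shows "kernel_gram j i = cnj (kernel_gram i j)"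
  unfolding kernel_gram_def
  using kernel_series_cnj[OF \<alpha> cmod_mult_disc[OF disc disc], OF assms] by (simp add: mult.commute)

text \<open>To bound the matrix of absolute values, the Bessel bound is tested on nonnegative
  coefficients only; for these the sector estimate can be summed. In \<open>M\<close>, the K goes
  with the real parts and the K^2 with the constant term.\<close>

lemma bounded_below_coloring_positive_order:
  assumes "\<alpha> > 0" and B: "B > 0"
    and upper: "\<And>F a. finite F \<Longrightarrow> F \<subseteq> {1..} \<Longrightarrow>
      Re (gram_form kernel_gram F (\<lambda>n. a n / of_real (kernel_norm n))) \<le> B * (\<Sum>n\<in>F. (cmod (a n))\<^sup>2)"
  obtains r :: nat where "\<And>n. \<exists>c::nat \<Rightarrow> nat. (\<forall>i. c i < r) \<and> (\<forall>F\<subseteq>{1..n}. monochromatic c F \<longrightarrow>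
       (\<forall>a. 1 / 2 * (\<Sum>n\<in>F. (cmod (a n))\<^sup>2) \<le> Re (gram_form kernel_gram F (\<lambda>n. a n / of_real (kernel_norm n)))))"
proof -
  obtain K where K: "K > 0" and sector: "\<And>x. cmod x < 1 \<Longrightarrow> cmod (kernel_series \<alpha> x) \<le> K * (Re (kernel_series \<alpha> x) + K)"
    using kernel_series_sector_bound[OF \<open>\<alpha> > 0\<close> \<alpha>(2)] by metis
  define M where "M = (K + K\<^sup>2) * B"
  have M: "M > 0" using K B by (simp add: M_def add_pos_pos)
  define r where "r = nat \<lceil>8 * M\<rceil>"
  have r: "8 * M \<le> real r" unfolding r_def by linarith
  show ?thesis
  proof (rule that[of r])
    fix N :: nat
    define S where "S = {1..N}"
    have S: "finite S" "\<And>i. i \<in> S \<Longrightarrow> i \<ge> 1" "S \<subseteq> {1..}" by (auto simp: S_def)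
    have pos: "kernel_norm i > 0" if "i \<in> S" for i
      using kernel_norm_pos S(2) that by blast
    \<comment> \<open>Zero off \<open>S\<close>, because symmetry and sign are required at all
      indices, whereas the point with index 0 is unrestricted.\<close>
    define A where "A = (\<lambda>i j. if i \<noteq> j \<and> i \<in> S \<and> j \<in> S
      then cmod (kernel_gram i j) / (kernel_norm i * kernel_norm j) else 0)"
    obtain c :: "nat \<Rightarrow> nat" where c: "\<And>i. c i < r"
      and pave: "\<And>F x. F \<subseteq> S \<Longrightarrow> monochromatic c F \<Longrightarrow>
           (\<Sum>i\<in>F. \<Sum>j\<in>F. A i j * x i * x j) \<le> 1 / 2 * (\<Sum>i\<in>F. (x i)\<^sup>2)"
    proof (rule nonneg_matrix_paving[OF S(1) M _ _ _ _ r, of A])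
      show "A i j = A j i" for i j
        using kernel_gram_commute[of i j] S(2) by (auto simp: A_def mult.commute)
      show "A i j \<ge> 0" for i j using pos by (auto simp: A_def less_imp_le)
      show "A i i = 0" for i by (simp add: A_def)
      fix x :: "nat \<Rightarrow> real" assume x: "\<And>i. x i \<ge> 0"
      define y where "y = (\<lambda>i. x i / kernel_norm i)"
      have y: "y i \<ge> 0" if "i \<in> S" for i using x pos[OF that] by (simp add: y_def)
      have "(\<Sum>i\<in>S. \<Sum>j\<in>S. A i j * x i * x j) \<le>
         (\<Sum>i\<in>S. \<Sum>j\<in>S. K * (y i * y j * Re (kernel_gram i j)) + K\<^sup>2 * (y i * y j))"
      proof (intro sum_mono)
        fix i j assume ij: "i \<in> S" "j \<in> S"
        have "A i j * x i * x j \<le> cmod (kernel_gram i j) * (y i * y j)"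
          using pos ij y[OF ij(1)] y[OF ij(2)] by (auto simp: A_def y_def)
        also have "\<dots> \<le> (K * (Re (kernel_gram i j) + K)) * (y i * y j)"
          unfolding kernel_gram_def using y ij S disc
          by (intro mult_right_mono sector cmod_mult_disc) auto
        finally show "A i j * x i * x j \<le> K * (y i * y j * Re (kernel_gram i j)) + K\<^sup>2 * (y i * y j)"
          by (simp add: algebra_simps power2_eq_square)
      qed
      also have "\<dots> = K * Re (gram_form kernel_gram S (\<lambda>i. of_real (y i))) + K\<^sup>2 * (\<Sum>i\<in>S. y i)\<^sup>2"
      proof -
        have "(\<Sum>i\<in>S. y i)\<^sup>2 = (\<Sum>i\<in>S. \<Sum>j\<in>S. y i * y j)"
          by (simp only: power2_eq_square sum_product)
        then show ?thesis by (simp add: gram_form_def sum.distrib sum_distrib_left)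
      qed
      also have "(\<Sum>i\<in>S. y i)\<^sup>2 \<le> Re (gram_form kernel_gram S (\<lambda>i. of_real (y i)))"
        using kernel_gram_form_ge_constant_term[OF S(1,3), of "\<lambda>i. of_real (y i)"]
        by (simp flip: of_real_sum)
      also have "K * Re (gram_form kernel_gram S (\<lambda>i. of_real (y i))) + K\<^sup>2 * Re (gram_form kernel_gram S (\<lambda>i. of_real (y i)))
         = (K + K\<^sup>2) * Re (gram_form kernel_gram S (\<lambda>i. of_real (y i)))"
        by (simp add: algebra_simps)
      also have "\<dots> \<le> (K + K\<^sup>2) * (B * (\<Sum>i\<in>S. (x i)\<^sup>2))"
        using upper[OF S(1,3), of "\<lambda>i. of_real (x i)"] K by (intro mult_left_mono) (auto simp: y_def)
      finally show "(\<Sum>i\<in>S. \<Sum>j\<in>S. A i j * x i * x j) \<le> M * (\<Sum>i\<in>S. (x i)\<^sup>2)"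
        using K by (simp add: M_def mult.assoc)
    qed (rule that)
    have "1 / 2 * (\<Sum>n\<in>F. (cmod (a n))\<^sup>2) \<le> Re (gram_form kernel_gram F (\<lambda>n. a n / of_real (kernel_norm n)))"
      if F: "F \<subseteq> {1..N}" "monochromatic c F" for F a
    proof -
      have FS: "F \<subseteq> S" "finite F" using F by (auto simp: S_def intro: finite_subset)
      \<comment> \<open>The normalized Gram matrix has diagonal 1, and its off-diagonal part is
        dominated by A, which takes away at most half of the diagonal on a class.\<close>
      have "(\<Sum>n\<in>F. (cmod (a n))\<^sup>2) - (\<Sum>i\<in>F. \<Sum>j\<in>F. A i j * cmod (a i) * cmod (a j))
         = (\<Sum>i\<in>F. \<Sum>j\<in>F. (if i = j then (cmod (a i))\<^sup>2 else 0) - A i j * cmod (a i) * cmod (a j))"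
        using FS by (simp add: sum_subtractf)
      also have "\<dots> \<le> (\<Sum>i\<in>F. \<Sum>j\<in>F. Re (a i / of_real (kernel_norm i) * cnj (a j / of_real (kernel_norm j)) * kernel_gram i j))"
      proof (intro sum_mono)
        fix i j assume "i \<in> F" "j \<in> F"
        then have ij: "i \<in> S" "j \<in> S" using FS by auto
        show "(if i = j then (cmod (a i))\<^sup>2 else 0) - A i j * cmod (a i) * cmod (a j)
          \<le> Re (a i / of_real (kernel_norm i) * cnj (a j / of_real (kernel_norm j)) * kernel_gram i j)"
        proof (cases "i = j")
          case True
          have "a i / of_real (kernel_norm i) * cnj (a i / of_real (kernel_norm i)) * kernel_gram i i
             = a i * cnj (a i)"
            using pos[OF ij(1)] kernel_norm_power2[OF S(2)[OF ij(1)], symmetric]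
            by (simp add: power2_eq_square)
          also have "\<dots> = of_real ((cmod (a i))\<^sup>2)"
            by (rule complex_norm_square[symmetric])
          finally have "a i / of_real (kernel_norm i) * cnj (a i / of_real (kernel_norm i)) * kernel_gram i i
             = of_real ((cmod (a i))\<^sup>2)" .
          then show ?thesis using True by (simp add: A_def)
        next
          case False
          have "cmod (a i / of_real (kernel_norm i) * cnj (a j / of_real (kernel_norm j)) * kernel_gram i j)
            = A i j * cmod (a i) * cmod (a j)"
            using False ij pos[OF ij(1)] pos[OF ij(2)] by (simp add: A_def norm_mult norm_divide)
          then show ?thesis using False
            abs_Re_le_cmod[of "a i / of_real (kernel_norm i) * cnj (a j / of_real (kernel_norm j)) * kernel_gram i j"]
            by (simp only: if_False)
        qed
      qed
      also have "\<dots> = Re (gram_form kernel_gram F (\<lambda>n. a n / of_real (kernel_norm n)))"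
        by (simp only: gram_form_def Re_sum)
      finally show ?thesis using pave[OF FS(1) F(2), of "\<lambda>i. cmod (a i)"] by linarith
    qed
    then show "\<exists>c::nat \<Rightarrow> nat. (\<forall>i. c i < r) \<and> (\<forall>F\<subseteq>{1..N}. monochromatic c F \<longrightarrow>
       (\<forall>a. 1 / 2 * (\<Sum>n\<in>F. (cmod (a n))\<^sup>2) \<le> Re (gram_form kernel_gram F (\<lambda>n. a n / of_real (kernel_norm n)))))"
      using c by blast
  qed
qed

end

section \<open>Order \<alpha> = 0: comparison with the Hardy space\<close>

lemma kernel_coeff_order_zero_ge: "1 / pi \<le> kernel_coeff 0 n"
proof (cases "n = 0")
  case True
  then show ?thesis using pi_ge_two by (simp add: divide_le_eq)
next
  case False
  have "pochhammer 2 n = (real n + 1) * fact n"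
    using pochhammer_rec[of "1::real" n] by (simp add: pochhammer_fact[symmetric] add.commute)
  then show ?thesis using False by (simp add: kernel_coeff_def field_simps)
qed

context
  fixes \<mu> :: "nat \<Rightarrow> complex"
  assumes disc: "\<And>n. n \<ge> 1 \<Longrightarrow> \<mu> n \<in> unit_disc"
begin

text \<open>The Hardy space norm of the Szego kernel at the n-th point. The value 1 at index 0,
  where the point is unrestricted, makes it positive everywhere.\<close>

definition szego_norm :: "nat \<Rightarrow> real" where
  "szego_norm n = (if n \<ge> 1 then 1 / sqrt (1 - (cmod (\<mu> n))\<^sup>2) else 1)"

definition szego_gram :: "nat \<Rightarrow> nat \<Rightarrow> complex" where
  "szego_gram i j = 1 / ((1 - cnj (\<mu> i) * \<mu> j) * of_real (szego_norm i * szego_norm j))"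

lemma one_minus_cmod_power2_pos: "n \<ge> 1 \<Longrightarrow> 1 - (cmod (\<mu> n))\<^sup>2 > 0"
  using disc[of n] abs_square_less_1[of "cmod (\<mu> n)"] by simp

lemma szego_norm_pos: "szego_norm n > 0"
  using one_minus_cmod_power2_pos by (simp add: szego_norm_def)

lemma szego_norm_power2: "n \<ge> 1 \<Longrightarrow> (szego_norm n)\<^sup>2 = 1 / (1 - (cmod (\<mu> n))\<^sup>2)"
  using one_minus_cmod_power2_pos[of n] by (simp add: szego_norm_def power_divide)

lemma szego_gram_form_sums:
  assumes F: "finite F" "F \<subseteq> {1..}"
  shows "(\<lambda>n. (cmod (\<Sum>i\<in>F. x i * cnj (\<mu> i) ^ n))\<^sup>2) sums
      Re (gram_form szego_gram F (\<lambda>i. x i * of_real (szego_norm i)))"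
proof -
  have "(\<lambda>n. 1 * (cmod (\<Sum>i\<in>F. x i * cnj (\<mu> i) ^ n))\<^sup>2) sums
      Re (gram_form (\<lambda>i j. (\<lambda>x. 1 / (1 - x)) (cnj (\<mu> i) * \<mu> j)) F x)"
  proof (rule gram_form_sums[OF F(1)])
    fix i j assume "i \<in> F" "j \<in> F"
    then have "cmod (cnj (\<mu> i) * \<mu> j) < 1" using F disc by (intro cmod_mult_disc) auto
    then show "(\<lambda>n. of_real 1 * (cnj (\<mu> i) * \<mu> j) ^ n) sums (1 / (1 - cnj (\<mu> i) * \<mu> j))"
      using geometric_sums[of "cnj (\<mu> i) * \<mu> j"] by simp
  qed
  moreover have "gram_form (\<lambda>i j. 1 / (1 - cnj (\<mu> i) * \<mu> j)) F x =
      gram_form szego_gram F (\<lambda>i. x i * of_real (szego_norm i))"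
    unfolding gram_form_def szego_gram_def using szego_norm_pos
    by (intro sum.cong refl) (simp add: less_imp_neq[symmetric])
  ultimately show ?thesis by simp
qed

text \<open>For \<alpha> = 0 the coefficients are (n + 1) / (pi n) for n > 0 and 1 for n = 0, all
  between 1 / pi and 1, so the two series compare term by term.\<close>

lemma gram_forms_comparable:
  assumes F: "finite F" "F \<subseteq> {1..}"
  shows "Re (gram_form szego_gram F (\<lambda>i. x i * of_real (szego_norm i))) \<le> pi * Re (gram_form (kernel_gram 0 \<mu>) F x)"
    and "Re (gram_form (kernel_gram 0 \<mu>) F x) \<le> Re (gram_form szego_gram F (\<lambda>i. x i * of_real (szego_norm i)))"
proof -
  let ?q = "\<lambda>n. (cmod (\<Sum>i\<in>F. x i * cnj (\<mu> i) ^ n))\<^sup>2"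
  have K: "(\<lambda>n. kernel_coeff 0 n * ?q n) sums Re (gram_form (kernel_gram 0 \<mu>) F x)"
    by (rule kernel_gram_form_sums) (use disc F in auto)
  have S: "?q sums Re (gram_form szego_gram F (\<lambda>i. x i * of_real (szego_norm i)))"
    by (rule szego_gram_form_sums[OF F])
  show "Re (gram_form (kernel_gram 0 \<mu>) F x) \<le> Re (gram_form szego_gram F (\<lambda>i. x i * of_real (szego_norm i)))"
  proof (rule sums_le[OF _ K S])
    show "kernel_coeff 0 n * ?q n \<le> ?q n" for n
      using mult_right_mono[OF kernel_coeff_le_1[of 0 n], of "?q n"] by simp
  qed
  have "1 / pi * Re (gram_form szego_gram F (\<lambda>i. x i * of_real (szego_norm i))) \<le> Re (gram_form (kernel_gram 0 \<mu>) F x)"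
  proof (rule sums_le[OF _ sums_mult[OF S] K])
    show "1 / pi * ?q n \<le> kernel_coeff 0 n * ?q n" for n
      by (rule mult_right_mono[OF kernel_coeff_order_zero_ge]) simp
  qed
  then show "Re (gram_form szego_gram F (\<lambda>i. x i * of_real (szego_norm i))) \<le> pi * Re (gram_form (kernel_gram 0 \<mu>) F x)"
    using pi_gt_zero by (simp add: divide_le_eq mult.commute)
qed

text \<open>This single inequality serves both changes of normalization: the Bessel bound moves to
  Szego kernels, and the lower bound moves back.\<close>

lemma kernel_norm_le_szego_norm:
  assumes "n \<ge> 1"
  shows "kernel_norm 0 \<mu> n \<le> szego_norm n"
proof (rule power2_le_imp_le)
  have nz: "1 - cnj (\<mu> n) * \<mu> n = of_real (1 - (cmod (\<mu> n))\<^sup>2)"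
    unfolding of_real_diff complex_norm_square by (simp add: mult.commute)
  have "(kernel_norm 0 \<mu> n)\<^sup>2 = Re (kernel_gram 0 \<mu> n n)"
    using arg_cong[OF kernel_norm_power2[of 0 \<mu> n], of Re] disc assms by simp
  also have "\<dots> \<le> Re (szego_gram n n * of_real (szego_norm n) * of_real (szego_norm n))"
    using gram_forms_comparable(2)[of "{n}" "\<lambda>_. 1"] assms by (simp add: gram_form_def mult_ac)
  also have "\<dots> = (szego_norm n)\<^sup>2"
    using szego_norm_pos[of n] one_minus_cmod_power2_pos[OF assms]
    unfolding szego_gram_def nz szego_norm_power2[OF assms] by simp
  finally show "(kernel_norm 0 \<mu> n)\<^sup>2 \<le> (szego_norm n)\<^sup>2" .
qed (use szego_norm_pos less_imp_le in blast)

text \<open>The cut is applied to the squares of the moduli: their row sums are bounded by the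
  Bessel hypothesis, and they are what the Blaschke products depend on. With r \<ge> 2 C colours the
  bound C drops to 1 / 2.\<close>

lemma bounded_below_coloring_order_zero:
  assumes B: "B > 0"
    and upper: "\<And>F a. finite F \<Longrightarrow> F \<subseteq> {1..} \<Longrightarrow>
      Re (gram_form (kernel_gram 0 \<mu>) F (\<lambda>n. a n / of_real (kernel_norm 0 \<mu> n))) \<le> B * (\<Sum>n\<in>F. (cmod (a n))\<^sup>2)"
  obtains r :: nat and A :: real where "A > 0" "\<And>n. \<exists>c::nat \<Rightarrow> nat. (\<forall>i. c i < r) \<and> (\<forall>F\<subseteq>{1..n}. monochromatic c F \<longrightarrow>
       (\<forall>a. A * (\<Sum>n\<in>F. (cmod (a n))\<^sup>2) \<le> Re (gram_form (kernel_gram 0 \<mu>) F (\<lambda>n. a n / of_real (kernel_norm 0 \<mu> n)))))"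
proof -
  define C where "C = pi * B"
  have C: "C > 0" using B by (simp add: C_def)
  have kpos: "kernel_norm 0 \<mu> n > 0" if "n \<ge> 1" for n
    by (rule kernel_norm_pos) (use disc that in auto)
  have herm: "szego_gram j i = cnj (szego_gram i j)" for i j
    by (simp add: szego_gram_def mult.commute)
  have szego_scaled: "gram_form szego_gram F x = gram_form szego_gram F (\<lambda>i. x i / of_real (szego_norm i) * of_real (szego_norm i))" for F x
    using szego_norm_pos by (simp add: less_imp_neq[symmetric])
  have lower: "0 \<le> Re (gram_form szego_gram F x)" if F: "finite F" "F \<subseteq> {1..}" for F x
    unfolding szego_scaled[of F x] by (rule sums_le[OF _ sums_zero szego_gram_form_sums[OF F]]) simp
  have szego_upper: "Re (gram_form szego_gram F x) \<le> C * (\<Sum>i\<in>F. (cmod (x i))\<^sup>2)"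
    if F: "finite F" "F \<subseteq> {1..}" for F x
  proof -
    define a where "a = (\<lambda>i. x i * of_real (kernel_norm 0 \<mu> i / szego_norm i))"
    have "Re (gram_form szego_gram F x) \<le> pi * Re (gram_form (kernel_gram 0 \<mu>) F (\<lambda>i. x i / of_real (szego_norm i)))"
      unfolding szego_scaled[of F x] by (rule gram_forms_comparable(1)[OF F])
    also have "gram_form (kernel_gram 0 \<mu>) F (\<lambda>i. x i / of_real (szego_norm i)) =
        gram_form (kernel_gram 0 \<mu>) F (\<lambda>i. a i / of_real (kernel_norm 0 \<mu> i))"
    proof -
      have "x i / of_real (szego_norm i) = a i / of_real (kernel_norm 0 \<mu> i)" if "i \<in> F" for i
        using kpos[of i] F that by (auto simp: a_def)
      then show ?thesis unfolding gram_form_def by (intro sum.cong) auto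
    qed
    also have "pi * Re \<dots> \<le> pi * (B * (\<Sum>i\<in>F. (cmod (a i))\<^sup>2))"
      using upper[OF F] by (intro mult_left_mono) auto
    also have "\<dots> \<le> pi * (B * (\<Sum>i\<in>F. (cmod (x i))\<^sup>2))"
    proof (intro mult_left_mono sum_mono)
      fix i assume "i \<in> F"
      then have i: "i \<ge> 1" using F by auto
      have "\<bar>kernel_norm 0 \<mu> i / szego_norm i\<bar> \<le> 1"
        using kernel_norm_le_szego_norm[OF i] kpos[OF i] szego_norm_pos[of i] by simp
      then have "cmod (a i) \<le> cmod (x i)"
        unfolding a_def norm_mult norm_of_real by (intro mult_right_le_one_le) auto
      then show "(cmod (a i))\<^sup>2 \<le> (cmod (x i))\<^sup>2" by (intro power_mono) auto
    qed (use B in auto)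
    finally show ?thesis by (simp add: C_def mult.assoc)
  qed
  define r where "r = nat \<lceil>2 * C\<rceil>"
  have r: "2 * C \<le> real r" unfolding r_def by linarith
  then have r0: "r > 0" using C by (cases r) auto
  show ?thesis
  \<comment> \<open>The factor 2 C comes from the Cauchy matrix argument, pi from the comparison of
    the forms.\<close>
  proof (rule that[of "1 / (2 * pi * C)" r])
    show "1 / (2 * pi * C) > 0" using C by simp
    fix N :: nat
    define S where "S = {1..N}"
    have S: "finite S" "S \<subseteq> {1..}" by (auto simp: S_def)
    define w where "w = (\<lambda>i j. if i = j then 0 else (cmod (szego_gram i j))\<^sup>2)"
    have cm: "cmod (szego_gram j i) = cmod (szego_gram i j)" for i j
      by (subst herm) simp
    have w: "w i j = w j i" "w i j \<ge> 0" "w i i = 0" for i j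
      by (cases "i = j") (auto simp: w_def cm[of i j])
    obtain c :: "nat \<Rightarrow> nat" where c: "\<And>i. c i < r"
      "\<And>F i. F \<subseteq> S \<Longrightarrow> monochromatic c F \<Longrightarrow> i \<in> F \<Longrightarrow> real r * (\<Sum>j\<in>F. w i j) \<le> (\<Sum>j\<in>S. w i j)"
      using monochromatic_cut[of S r w, OF S(1) r0 w] by metis
    have row: "(\<Sum>j\<in>S. w i j) \<le> C" if i: "i \<in> S" for i
    proof -
      \<comment> \<open>The inequality G^2 \<le> C G at a unit vector bounds the squared norm of a
        row of G by C times a diagonal entry, which is 1.\<close>
      let ?\<delta> = "\<lambda>k. if k = i then 1 else 0 :: complex"
      have i1: "i \<ge> 1" using S i by auto
      have nz: "1 - cnj (\<mu> i) * \<mu> i = of_real (1 - (cmod (\<mu> i))\<^sup>2)"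
        unfolding of_real_diff complex_norm_square by (simp add: mult.commute)
      have "szego_gram i i = of_real (1 / ((1 - (cmod (\<mu> i))\<^sup>2) * (szego_norm i)\<^sup>2))"
        unfolding szego_gram_def nz by (simp add: power2_eq_square)
      then have gii: "szego_gram i i = 1"
        using one_minus_cmod_power2_pos[OF i1] by (simp add: szego_norm_power2[OF i1])
      have "(\<Sum>j\<in>S. w i j) \<le> (\<Sum>j\<in>S. (cmod (szego_gram i j))\<^sup>2)"
        by (intro sum_mono) (simp add: w_def)
      also have "\<dots> = (\<Sum>j\<in>S. (cmod (\<Sum>k\<in>S. ?\<delta> k * szego_gram k j))\<^sup>2)"
        using S i by (simp add: if_distrib[of "\<lambda>x. x * _"] cong: if_cong)
      also have "\<dots> \<le> C * Re (gram_form szego_gram S ?\<delta>)"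
        using lower[OF S] szego_upper[OF S] by (intro gram_form_bound_imp_norm_bound herm C) auto
      also have "gram_form szego_gram S ?\<delta> = 1"
      proof -
        have "gram_form szego_gram S ?\<delta> =
            (\<Sum>a\<in>S. if a = i then (\<Sum>b\<in>S. if b = i then szego_gram i i else 0) else 0)"
          unfolding gram_form_def by (intro sum.cong refl) (auto intro!: sum.cong sum.neutral)
        then show ?thesis using S i by (simp add: gii)
      qed
      finally show ?thesis by simp
    qed
    have "1 / (2 * pi * C) * (\<Sum>n\<in>F. (cmod (a n))\<^sup>2) \<le>
        Re (gram_form (kernel_gram 0 \<mu>) F (\<lambda>n. a n / of_real (kernel_norm 0 \<mu> n)))"
      if F: "F \<subseteq> {1..N}" "monochromatic c F" for F a
    proof -
      have FS: "F \<subseteq> S" "finite F" "F \<subseteq> {1..}" using F by (auto simp: S_def intro: finite_subset)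
      have sep: "(\<Sum>j\<in>F-{i}. (cmod (szego_gram i j))\<^sup>2) \<le> 1 / 2" if i: "i \<in> F" for i
      proof -
        have "(\<Sum>j\<in>F-{i}. (cmod (szego_gram i j))\<^sup>2) = (\<Sum>j\<in>F-{i}. w i j)"
          by (intro sum.cong) (auto simp: w_def)
        also have "\<dots> = (\<Sum>j\<in>F. w i j)"
          using FS i by (simp add: sum.remove w_def)
        finally have "real r * (\<Sum>j\<in>F-{i}. (cmod (szego_gram i j))\<^sup>2) \<le> C"
          using c(2)[OF FS(1) F(2) i] row[of i] FS(1) i by (simp add: subset_iff)
        also have "C \<le> real r * (1 / 2)" using r by simp
        finally show ?thesis using r0 by simp
      qed
      define b where "b = (\<lambda>n. a n / of_real (kernel_norm 0 \<mu> n))"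
      have "(\<Sum>n\<in>F. (cmod (a n))\<^sup>2) \<le> (\<Sum>n\<in>F. (cmod (b n * of_real (szego_norm n)))\<^sup>2)"
      proof (intro sum_mono power_mono)
        fix n assume "n \<in> F"
        then have n: "n \<ge> 1" using FS by auto
        have "1 \<le> szego_norm n / kernel_norm 0 \<mu> n"
          using kernel_norm_le_szego_norm[OF n] kpos[OF n] by simp
        from mult_left_mono[OF this, of "cmod (a n)"]
        show "cmod (a n) \<le> cmod (b n * of_real (szego_norm n))"
          using kpos[OF n] szego_norm_pos[of n] by (simp add: b_def norm_mult norm_divide)
      qed auto
      also have "\<dots> \<le> 2 * C * Re (gram_form szego_gram F (\<lambda>n. b n * of_real (szego_norm n)))"
      proof (rule szego_gram_lower_bound[where \<nu> = \<mu> and s = szego_norm])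
        show "(szego_norm i)\<^sup>2 = 1 / (1 - (cmod (\<mu> i))\<^sup>2)" if "i \<in> F" for i
          using that FS by (intro szego_norm_power2) auto
      qed (use FS disc szego_norm_pos C lower szego_upper sep in \<open>auto simp: szego_gram_def\<close>)
      also have "\<dots> \<le> 2 * C * (pi * Re (gram_form (kernel_gram 0 \<mu>) F b))"
        using C FS by (intro mult_left_mono gram_forms_comparable(1)) auto
      finally show ?thesis using C by (simp add: b_def field_simps)
    qed
    then show "\<exists>c::nat \<Rightarrow> nat. (\<forall>i. c i < r) \<and> (\<forall>F\<subseteq>{1..N}. monochromatic c F \<longrightarrow>
       (\<forall>a. 1 / (2 * pi * C) * (\<Sum>n\<in>F. (cmod (a n))\<^sup>2) \<le>
         Re (gram_form (kernel_gram 0 \<mu>) F (\<lambda>n. a n / of_real (kernel_norm 0 \<mu> n)))))"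
      using c(1) by blast
  qed
qed

end

section \<open>The Feichtinger property for all orders between 0 and 1\<close>

theorem corollary4p1:
  fixes \<alpha> :: real and \<mu> :: "nat \<Rightarrow> complex"
  assumes "0 \<le> \<alpha>" and "\<alpha> \<le> 1"
    and "\<And>n. n \<ge> 1 \<Longrightarrow> \<mu> n \<in> unit_disc"
    and "bessel_sequence (dirichlet_norm \<alpha>) {1..}
           (\<lambda>n. normalized_dirichlet_kernel \<alpha> (\<mu> n))"
  shows "\<exists>(r::nat) (J :: nat \<Rightarrow> nat set).
           (\<Union>j\<in>{1..r}. J j) = {1..} \<and> disjoint_family_on J {1..r} \<and>
           (\<forall>j\<in>{1..r}. riesz_sequence (dirichlet_norm \<alpha>) (J j)
              (\<lambda>n. normalized_dirichlet_kernel \<alpha> (\<mu> n)))"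
proof -
  note norm = normalized_kernel_combination_norm[OF assms(1-3)]
  obtain B where B: "B > 0" and upper: "\<And>F a. finite F \<Longrightarrow> F \<subseteq> {1..} \<Longrightarrow>
      Re (gram_form (kernel_gram \<alpha> \<mu>) F (\<lambda>n. a n / of_real (kernel_norm \<alpha> \<mu> n))) \<le> B * (\<Sum>n\<in>F. (cmod (a n))\<^sup>2)"
  proof -
    obtain B where B: "B > 0" "\<And>F a. finite F \<Longrightarrow> F \<subseteq> {1..} \<Longrightarrow>
      (dirichlet_norm \<alpha> (\<lambda>z. \<Sum>n\<in>F. a n * normalized_dirichlet_kernel \<alpha> (\<mu> n) z))\<^sup>2 \<le> B * (\<Sum>n\<in>F. (cmod (a n))\<^sup>2)"
      by (rule bessel_sequenceE[OF assms(4)], rule that)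
    show ?thesis
    proof (rule that[OF B(1)])
      fix F :: "nat set" and a :: "nat \<Rightarrow> complex" assume F: "finite F" "F \<subseteq> {1..}"
      show "Re (gram_form (kernel_gram \<alpha> \<mu>) F (\<lambda>n. a n / of_real (kernel_norm \<alpha> \<mu> n))) \<le> B * (\<Sum>n\<in>F. (cmod (a n))\<^sup>2)"
        using B(2)[OF F, of a] by (simp only: norm[OF _ F])
    qed
  qed
  \<comment> \<open>Both cases end in the same finite statement; r and A are fixed before n, as the
    passage to the infinite index set requires.\<close>
  obtain r :: nat and A :: real where A: "A > 0" and col: "\<And>n. \<exists>c::nat \<Rightarrow> nat. (\<forall>i. c i < r) \<and> (\<forall>F\<subseteq>{1..n}. monochromatic c F \<longrightarrow>
       (\<forall>a. A * (\<Sum>n\<in>F. (cmod (a n))\<^sup>2) \<le> Re (gram_form (kernel_gram \<alpha> \<mu>) F (\<lambda>n. a n / of_real (kernel_norm \<alpha> \<mu> n)))))"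
  proof (cases "\<alpha> = 0")
    case True
    show ?thesis
      by (rule bounded_below_coloring_order_zero[OF assms(3) B upper[unfolded True]])
         (assumption+, rule that[unfolded True])
  next
    case False
    then have "\<alpha> > 0" using assms(1) by simp
    show ?thesis
      by (rule bounded_below_coloring_positive_order[OF assms(1-3) \<open>\<alpha> > 0\<close> B upper])
         (assumption+, rule that[of "1 / 2"], simp)
  qed
  show ?thesis
  proof (rule riesz_partition_from_finite_colorings[OF assms(4) A])
    fix n
    obtain c :: "nat \<Rightarrow> nat" where c: "\<And>i. c i < r" "\<And>F a. F \<subseteq> {1..n} \<Longrightarrow> monochromatic c F \<Longrightarrow>
      A * (\<Sum>n\<in>F. (cmod (a n))\<^sup>2) \<le> Re (gram_form (kernel_gram \<alpha> \<mu>) F (\<lambda>n. a n / of_real (kernel_norm \<alpha> \<mu> n)))"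
      using col[of n] by blast
    have "A * (\<Sum>n\<in>F. (cmod (a n))\<^sup>2) \<le> (dirichlet_norm \<alpha> (\<lambda>z. \<Sum>n\<in>F. a n * normalized_dirichlet_kernel \<alpha> (\<mu> n) z))\<^sup>2"
      if "F \<subseteq> {1..n}" "monochromatic c F" for F a
      using c(2)[OF that, of a] that(1) finite_subset[OF that(1)] by (subst norm) auto
    then show "\<exists>c::nat \<Rightarrow> nat. (\<forall>i. c i < r) \<and> (\<forall>F\<subseteq>{1..n}. monochromatic c F \<longrightarrow>
       (\<forall>a. A * (\<Sum>n\<in>F. (cmod (a n))\<^sup>2) \<le>
         (dirichlet_norm \<alpha> (\<lambda>z. \<Sum>n\<in>F. a n * normalized_dirichlet_kernel \<alpha> (\<mu> n) z))\<^sup>2))"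
      using c(1) by blast
  qed
qed

end
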